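(* Let $f:\mathbb{R}^m\to\mathbb{R}$ be convex, $L$-smooth and generalized strongly convex, let $\mathcal{X}=\mathcal{X}_1\times\cdots\times\mathcal{X}_K$ be a polytope with each $\mathcal{X}_k\subset\mathbb{R}^{d_k}$ convex and compact, let $\lambda>0$, and assume there exist $\bar{x}^{(k)}\in\mathrm{relint}(\mathcal{X}_k)$, $k=1,\dots,K$, with $\sum_{k=1}^K A_k\bar{x}^{(k)}=0$. Let $D:=\max_{x,x'\in\mathcal{X}}\|x-x'\|$ and $L_\lambda:=L+\lambda\|M^\top M\|$. Let $(x_t,y_t)_{t\ge0}$ be generated by FW-AL with inner loop the away-step Frank-Wolfe algorithm (one non-drop step) and constant dual step size $\eta_t=\frac{\lambda\rho_A}{4}$, where $\rho_A$ is the geometric decrease constant of the inner loop. Then there exists a constant $\alpha>0$, depending only on $f,\mathcal{X},M,\lambda$ and satisfying $$d^*-d(y)\ge\tfrac{\alpha^2}{2}\min\{\mathrm{dist}(y,\mathcal{Y}^* )^2/(L_\lambda D^2),\ \mathrm{dist}(y,\mathcal{Y}^* )\}\quad\text{for all }y\in\mathbb{R}^n,$$ such that the following holds. The quantity $\Delta_t$ decreases by a uniform amount for a finite number of steps $t_0$, $$\Delta_{t+1}-\Delta_t\le-\frac{\lambda\alpha^2\rho_A}{8}\qquad(0\le t<t_0),$$ until $\Delta_{t_0}\le L_\lambda D^2$; and then for all $t\ge t_0$, $$\Delta_t\le\frac{\Delta_{t_0}}{(1+\rho)^{t-t_0}},\qquad \|Mx_{t+1}\|^2\le\frac{16}{\lambda\rho_A}\,\frac{\Delta_{t_0}}{(1+\rho)^{t-t_0}},$$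 where $\rho:=\min\left\{\frac{\rho_A}{2},\frac{\rho_A\lambda\alpha^2}{8L_\lambda D^2}\right\}$.
   Context: Setting: $m=d_1+\dots+d_K$, $x=(x^{(1)},\dots,x^{(K)})$; $A_k$ is a real $n\times d_k$ matrix, $M:=[A_1,\dots,A_K]$, so $Mx=\sum_k A_kx^{(k)}$. $\mathcal{L}(x,y):=f(x)+\langle y,Mx\rangle+\tfrac{\lambda}{2}\|Mx\|^2$; $d(y):=\min_{x\in\mathcal{X}}\mathcal{L}(x,y)$, $d^*:=\max_{y\in\mathbb{R}^n}d(y)$, $\mathcal{Y}^*:=\arg\max_y d(y)$. $\|\cdot\|$ is the Euclidean norm (spectral norm for matrices), $\mathrm{dist}$ the Euclidean distance to a set, $\mathrm{relint}$ the relative interior. $L$-smooth: differentiable with $L$-Lipschitz gradient on $\mathbb{R}^m$. Generalized strongly convex: $f(x)=g(Ax)+\langle b,x\rangle$ for some matrix $A$, vector $b$ and $\mu_g$-strongly convex $g$ with $\mu_g>0$. FW-AL: starting from $x_0\in\mathcal{X}$ (a vertex) and $y_0\in\mathbb{R}^n$, for $t\ge0$: $x_{t+1}:=\mathcal{FW}(x_t;\mathcal{L}(\cdot,y_t))$, $y_{t+1}:=y_t+\eta_tMx_{t+1}$. Inner loop $\mathcal{FW}$ (away-step Frank-Wolfe, one non-drop step), with objective $\varphi=\mathcal{L}(\cdot,y_t)$: the current point is kept as a convex combination $x=\sum_{v\in\mathcal{S}}\alpha_v v$ with $\alpha_v>0$ of an active set $\mathcal{S}$ of vertices of $\mathcal{X}$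 (maintained across iterations). Repeat: let $s\in\arg\min_{s\in\mathcal{X}}\langle\nabla\varphi(x),s\rangle$ (a vertex) and $v\in\arg\max_{v\in\mathcal{S}}\langle\nabla\varphi(x),v\rangle$; if $\langle\nabla\varphi(x),x-s\rangle\ge\langle\nabla\varphi(x),v-x\rangle$ take direction $\mathbf{d}=s-x$, $\gamma_{\max}=1$, else $\mathbf{d}=x-v$, $\gamma_{\max}=\alpha_v/(1-\alpha_v)$; choose $\gamma\in\arg\min_{\gamma\in[0,\gamma_{\max}]}\varphi(x+\gamma\mathbf{d})$; update $x\leftarrow x+\gamma\mathbf{d}$, the weights, and $\mathcal{S}$ (vertices of positive weight); stop after the first step with $\gamma<\gamma_{\max}$ and return $x$ and $\mathcal{S}$. Geometric decrease constant: $\rho_A\in(0,1)$ is a constant such that for every $x\in\mathcal{X}$, $y\in\mathbb{R}^n$, the output $x^+:=\mathcal{FW}(x;\mathcal{L}(\cdot,y))$ satisfies $\mathcal{L}(x^+,y)-\mathcal{L}(x,y)\le\rho_A\,[\min_{x'\in\mathcal{X}}\mathcal{L}(x',y)-\mathcal{L}(x,y)]$. It is a known result of Lacoste-Julien and Jaggi that such a constant exists for this inner loop when $\mathcal{X}$ is a polytope and $f$ is generalized strongly convex; this may be taken as given. Gaps: $\Delta_t^{(d)}:=d^*-d(y_t)$, $\Delta_t^{(p)}:=\mathcal{L}(x_{t+1},y_t)-d(y_t)$, $\Delta_t:=\Delta_t^{(p)}+\Delta_t^{(d)}$. *)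

theory Defs
  imports "HOL-Analysis.Analysis"
begin

(* The coordinates 'm of R^m are partitioned into blocks 'k by blk :: 'm => 'k, so that
   d_k = card {j. blk j = k}.  The factor R^(d_k) is the coordinate subspace
   block_space blk k of real^'m, and the k-th component of x is block blk k x.
   An n x d_k matrix A k is stored in a real^'m^'n; only its columns j with blk j = k
   matter, the others are never used. *)

definition block :: "('m::finite \<Rightarrow> 'k) \<Rightarrow> 'k \<Rightarrow> real^'m \<Rightarrow> real^'m" where
  "block blk k x = (\<chi> j. if blk j = k then x $ j else 0)"

definition block_space :: "('m::finite \<Rightarrow> 'k) \<Rightarrow> 'k \<Rightarrow> (real^'m) set" where
  "block_space blk k = {x. \<forall>j. blk j \<noteq> k \<longrightarrow> x $ j = 0}"

definition block_product :: "('m::finite \<Rightarrow> 'k) \<Rightarrow> ('k \<Rightarrow> (real^'m) set) \<Rightarrow> (real^'m) set" where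
  "block_product blk Xs = {x. \<forall>k. block blk k x \<in> Xs k}"

definition block_matrix :: "('m::finite \<Rightarrow> 'k) \<Rightarrow> ('k \<Rightarrow> real^'m^'n::finite) \<Rightarrow> real^'m^'n" where
  "block_matrix blk A = (\<chi> i j. A (blk j) $ i $ j)"

lemma block_matrix_mult:
  fixes blk :: "'m::finite \<Rightarrow> 'k::finite" and A :: "'k \<Rightarrow> real^'m^'n::finite"
  shows "block_matrix blk A *v x = (\<Sum>k\<in>UNIV. A k *v block blk k x)"
proof -
  have "(\<Sum>k\<in>UNIV. A k $ i $ j * (if blk j = k then x $ j else 0)) = A (blk j) $ i $ j * x $ j"
    for i j
    by (simp add: if_distrib[of "(*) _"] cong: if_cong)
  then have "(\<Sum>j\<in>UNIV. A (blk j) $ i $ j * x $ j)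
      = (\<Sum>k\<in>UNIV. \<Sum>j\<in>UNIV. A k $ i $ j * (if blk j = k then x $ j else 0))" for i
    by (subst sum.swap) simp
  then show ?thesis
    by (simp add: vec_eq_iff matrix_vector_mult_def block_matrix_def block_def)
qed

definition grad :: "('a::real_inner \<Rightarrow> real) \<Rightarrow> 'a \<Rightarrow> 'a" where
  "grad \<phi> x = (THE D. GDERIV \<phi> x :> D)"

definition L_smooth :: "real \<Rightarrow> ('a::euclidean_space \<Rightarrow> real) \<Rightarrow> bool" where
  "L_smooth L f \<longleftrightarrow> (\<forall>x. f differentiable (at x)) \<and> L-lipschitz_on UNIV (grad f)"

definition strongly_convex :: "real \<Rightarrow> ('a::real_inner \<Rightarrow> real) \<Rightarrow> bool" where
  "strongly_convex \<mu> g \<longleftrightarrow>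
     (\<forall>x y. \<forall>u\<in>{0..1}. g (u *\<^sub>R x + (1 - u) *\<^sub>R y)
        \<le> u * g x + (1 - u) * g y - \<mu> / 2 * u * (1 - u) * (norm (x - y))\<^sup>2)"

definition generalized_strongly_convex :: "'p::finite itself \<Rightarrow> (real^'m::finite \<Rightarrow> real) \<Rightarrow> bool" where
  "generalized_strongly_convex _ f \<longleftrightarrow>
     (\<exists>(B :: real^'m^'p) b g \<mu>. 0 < \<mu> \<and> strongly_convex \<mu> g \<and> (\<forall>x. f x = g (B *v x) + b \<bullet> x))"

definition aug_lagrangian ::
  "(real^'m::finite \<Rightarrow> real) \<Rightarrow> real^'m^'n::finite \<Rightarrow> real \<Rightarrow> real^'m \<Rightarrow> real^'n \<Rightarrow> real" where
  "aug_lagrangian f M lam x y = f x + y \<bullet> (M *v x) + lam / 2 * (norm (M *v x))\<^sup>2"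

(* X is compact and nonempty in all uses, so INF is an attained minimum. *)
definition dual_fun ::
  "(real^'m::finite \<Rightarrow> real) \<Rightarrow> real^'m^'n::finite \<Rightarrow> real \<Rightarrow> (real^'m) set \<Rightarrow> real^'n \<Rightarrow> real" where
  "dual_fun f M lam X y = (INF x\<in>X. aug_lagrangian f M lam x y)"

(* The supremum is attained under the relative interior condition of the theorem. *)
definition dual_opt ::
  "(real^'m::finite \<Rightarrow> real) \<Rightarrow> real^'m^'n::finite \<Rightarrow> real \<Rightarrow> (real^'m) set \<Rightarrow> real" where
  "dual_opt f M lam X = (SUP y. dual_fun f M lam X y)"

definition dual_argmax ::
  "(real^'m::finite \<Rightarrow> real) \<Rightarrow> real^'m^'n::finite \<Rightarrow> real \<Rightarrow> (real^'m) set \<Rightarrow> (real^'n) set" where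
  "dual_argmax f M lam X = {y. is_arg_max (dual_fun f M lam X) (\<lambda>_. True) y}"

(* onorm is the spectral norm; the type class norm on matrices is the Frobenius norm. *)
definition smooth_const :: "real \<Rightarrow> real \<Rightarrow> real^'m^'n::finite \<Rightarrow> real" where
  "smooth_const L lam M = L + lam * onorm ((*v) (transpose M ** M))"

(* The state (x, w) consists of the current point and the weights; the active set is
   {v. 0 < w v}. *)
type_synonym 'm state = "(real^'m) \<times> (real^'m \<Rightarrow> real)"

definition valid_state :: "(real^'m::finite) set \<Rightarrow> 'm state \<Rightarrow> bool" where
  "valid_state X = (\<lambda>(x, w). (\<forall>v. 0 \<le> w v) \<and> finite {v. 0 < w v}
     \<and> (\<forall>v. 0 < w v \<longrightarrow> v extreme_point_of X)
     \<and> (\<Sum>v | 0 < w v. w v) = 1 \<and> (\<Sum>v | 0 < w v. w v *\<^sub>R v) = x)"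

(* afw_step X phi st gamma gamma_max st'.  In the away case w v < 1: if v were the only
   active vertex, then x = v and the first case would apply. *)
inductive afw_step ::
  "(real^'m::finite) set \<Rightarrow> (real^'m \<Rightarrow> real) \<Rightarrow> 'm state \<Rightarrow> real \<Rightarrow> real \<Rightarrow> 'm state \<Rightarrow> bool"
  for X \<phi> where
  frank_wolfe:
    "s extreme_point_of X \<Longrightarrow> is_arg_min (\<lambda>z. grad \<phi> x \<bullet> z) (\<lambda>z. z \<in> X) s \<Longrightarrow>
     is_arg_max (\<lambda>z. grad \<phi> x \<bullet> z) (\<lambda>z. 0 < w z) v \<Longrightarrow>
     grad \<phi> x \<bullet> (x - s) \<ge> grad \<phi> x \<bullet> (v - x) \<Longrightarrow>
     \<gamma>\<^sub>m = 1 \<Longrightarrow>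
     is_arg_min (\<lambda>\<gamma>. \<phi> (x + \<gamma> *\<^sub>R (s - x))) (\<lambda>\<gamma>. \<gamma> \<in> {0..\<gamma>\<^sub>m}) \<gamma> \<Longrightarrow>
     afw_step X \<phi> (x, w) \<gamma> \<gamma>\<^sub>m
       (x + \<gamma> *\<^sub>R (s - x), \<lambda>u. (1 - \<gamma>) * w u + (if u = s then \<gamma> else 0))"
| away:
    "s extreme_point_of X \<Longrightarrow> is_arg_min (\<lambda>z. grad \<phi> x \<bullet> z) (\<lambda>z. z \<in> X) s \<Longrightarrow>
     is_arg_max (\<lambda>z. grad \<phi> x \<bullet> z) (\<lambda>z. 0 < w z) v \<Longrightarrow>
     grad \<phi> x \<bullet> (x - s) < grad \<phi> x \<bullet> (v - x) \<Longrightarrow>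
     \<gamma>\<^sub>m = w v / (1 - w v) \<Longrightarrow>
     is_arg_min (\<lambda>\<gamma>. \<phi> (x + \<gamma> *\<^sub>R (x - v))) (\<lambda>\<gamma>. \<gamma> \<in> {0..\<gamma>\<^sub>m}) \<gamma> \<Longrightarrow>
     afw_step X \<phi> (x, w) \<gamma> \<gamma>\<^sub>m
       (x + \<gamma> *\<^sub>R (x - v), \<lambda>u. (1 + \<gamma>) * w u - (if u = v then \<gamma> else 0))"

(* A relation, since ties in the arg min / arg max may be broken in any way. *)
inductive afw_loop ::
  "(real^'m::finite) set \<Rightarrow> (real^'m \<Rightarrow> real) \<Rightarrow> 'm state \<Rightarrow> 'm state \<Rightarrow> bool"
  for X \<phi> where
  stop: "afw_step X \<phi> st \<gamma> \<gamma>\<^sub>m st' \<Longrightarrow> \<gamma> < \<gamma>\<^sub>m \<Longrightarrow> afw_loop X \<phi> st st'"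
| continue: "afw_step X \<phi> st \<gamma> \<gamma>\<^sub>m st' \<Longrightarrow> \<not> \<gamma> < \<gamma>\<^sub>m \<Longrightarrow> afw_loop X \<phi> st' st'' \<Longrightarrow>
    afw_loop X \<phi> st st''"

(* The output of the inner loop also depends on the active set, hence the quantification
   over all weights representing x. *)
definition geometric_decrease ::
  "(real^'m::finite \<Rightarrow> real) \<Rightarrow> real^'m^'n::finite \<Rightarrow> real \<Rightarrow> (real^'m) set \<Rightarrow> real \<Rightarrow> bool" where
  "geometric_decrease f M lam X \<rho>\<^sub>A \<longleftrightarrow> 0 < \<rho>\<^sub>A \<and> \<rho>\<^sub>A < 1 \<and>
     (\<forall>x w y x' w'. x \<in> X \<longrightarrow> valid_state X (x, w) \<longrightarrow>
        afw_loop X (\<lambda>z. aug_lagrangian f M lam z y) (x, w) (x', w') \<longrightarrow>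
        aug_lagrangian f M lam x' y - aug_lagrangian f M lam x y
          \<le> \<rho>\<^sub>A * (dual_fun f M lam X y - aug_lagrangian f M lam x y))"

definition FW_AL ::
  "(real^'m::finite \<Rightarrow> real) \<Rightarrow> real^'m^'n::finite \<Rightarrow> real \<Rightarrow> (real^'m) set \<Rightarrow> (nat \<Rightarrow> real)
     \<Rightarrow> (nat \<Rightarrow> real^'m) \<Rightarrow> (nat \<Rightarrow> real^'m \<Rightarrow> real) \<Rightarrow> (nat \<Rightarrow> real^'n) \<Rightarrow> bool" where
  "FW_AL f M lam X \<eta> x w y \<longleftrightarrow>
     x 0 extreme_point_of X \<and> w 0 = (\<lambda>v. if v = x 0 then 1 else 0) \<and>
     (\<forall>t. afw_loop X (\<lambda>z. aug_lagrangian f M lam z (y t)) (x t, w t) (x (Suc t), w (Suc t)) \<and>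
          y (Suc t) = y t + \<eta> t *\<^sub>R (M *v x (Suc t)))"

definition dual_gap ::
  "(real^'m::finite \<Rightarrow> real) \<Rightarrow> real^'m^'n::finite \<Rightarrow> real \<Rightarrow> (real^'m) set
     \<Rightarrow> (nat \<Rightarrow> real^'n) \<Rightarrow> nat \<Rightarrow> real" where
  "dual_gap f M lam X y t = dual_opt f M lam X - dual_fun f M lam X (y t)"

definition primal_gap ::
  "(real^'m::finite \<Rightarrow> real) \<Rightarrow> real^'m^'n::finite \<Rightarrow> real \<Rightarrow> (real^'m) set
     \<Rightarrow> (nat \<Rightarrow> real^'m) \<Rightarrow> (nat \<Rightarrow> real^'n) \<Rightarrow> nat \<Rightarrow> real" where
  "primal_gap f M lam X x y t =
     aug_lagrangian f M lam (x (Suc t)) (y t) - dual_fun f M lam X (y t)"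

definition total_gap ::
  "(real^'m::finite \<Rightarrow> real) \<Rightarrow> real^'m^'n::finite \<Rightarrow> real \<Rightarrow> (real^'m) set
     \<Rightarrow> (nat \<Rightarrow> real^'m) \<Rightarrow> (nat \<Rightarrow> real^'n) \<Rightarrow> nat \<Rightarrow> real" where
  "total_gap f M lam X x y t = primal_gap f M lam X x y t + dual_gap f M lam X y t"

end

theory Submission
  imports Defs
begin

text \<open>
  Let \<open>g\<close> be the gradient of \<open>f\<close> at a minimiser \<open>x*\<close> of \<open>f\<close> over \<open>X \<inter> ker M\<close>, and
  \<open>h y = max {\<langle>g + M\<^sup>T y, x* - x\<rangle> | x \<in> X}\<close>. The function \<open>h\<close> is polyhedral and its zero set, which
  is nonempty by linear programming duality, consists of dual solutions, so Hoffman's bound gives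
  \<open>h y \<ge> c dist(y, Y*)\<close>. Moving from \<open>x*\<close> towards a maximiser gives
  \<open>d* - d y \<ge> \<gamma> h y - \<gamma>\<^sup>2 C\<close> for \<open>\<gamma> \<in> [0, 1]\<close>, where \<open>C = L\<^sub>\<lambda> D\<^sup>2\<close>; this yields the error bound.

  With \<open>x'\<close> a minimiser of the Lagrangian at the new multiplier, one iteration changes the total
  gap by at most \<open>\<eta> \<parallel>M x - M x'\<parallel>\<^sup>2 - \<eta> \<parallel>M x'\<parallel>\<^sup>2 - \<rho>\<^sub>A G\<close>, where \<open>G \<ge> \<lambda>/2 \<parallel>M x - M x'\<parallel>\<^sup>2\<close>
  bounds the new primal gap. As \<open>M x'\<close> is a supergradient of \<open>d\<close>, the error bound turns
  \<open>\<parallel>M x'\<parallel>\<^sup>2\<close> into a multiple of \<open>min (dual gap / C) 1\<close>.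
\<close>

section \<open>Gradients of convex functions\<close>

lemma GDERIV_unique:
  fixes x :: "'a::real_inner"
  assumes "GDERIV f x :> D" and "GDERIV f x :> D'"
  shows "D = D'"
proof -
  have "(\<lambda>h. h \<bullet> D) = (\<lambda>h. h \<bullet> D')"
    using assms unfolding gderiv_def by (rule has_derivative_unique)
  then show ?thesis
    by (metis vector_eq_ldot)
qed

lemma grad_eqI: "GDERIV f x :> D \<Longrightarrow> grad f x = D"
  unfolding grad_def by (blast intro: GDERIV_unique)

text \<open>A derivative \<open>F\<close> with real values is the inner product with
  \<open>adjoint F 1\<close>, so differentiability suffices for the definite description in
  \<open>grad\<close> to denote the gradient.\<close>

lemma GDERIV_grad:
  fixes f :: "'a::euclidean_space \<Rightarrow> real"
  assumes "f differentiable (at x)"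
  shows "GDERIV f x :> grad f x"
proof -
  obtain F where F: "(f has_derivative F) (at x)"
    using assms unfolding differentiable_def by blast
  then have "F = (\<lambda>h. h \<bullet> adjoint F 1)"
    using adjoint_works[of F _ 1] has_derivative_linear by (fastforce simp: inner_commute)
  with F have "GDERIV f x :> adjoint F 1"
    by (simp add: gderiv_def)
  then show ?thesis
    using grad_eqI by metis
qed

lemma DERIV_along_line:
  fixes f :: "'a::euclidean_space \<Rightarrow> real"
  assumes "f differentiable (at (x + t *\<^sub>R d))"
  shows "((\<lambda>t. f (x + t *\<^sub>R d)) has_real_derivative grad f (x + t *\<^sub>R d) \<bullet> d) (at t)"
proof -
  have "((\<lambda>t. f (x + t *\<^sub>R d)) has_derivative (\<lambda>s. (s *\<^sub>R d) \<bullet> grad f (x + t *\<^sub>R d))) (at t)"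
  proof (rule has_derivative_compose[where f = "\<lambda>t. x + t *\<^sub>R d"])
    show "((\<lambda>t. x + t *\<^sub>R d) has_derivative (\<lambda>s. s *\<^sub>R d)) (at t)"
      by (auto intro!: derivative_eq_intros)
    show "(f has_derivative (\<lambda>h. h \<bullet> grad f (x + t *\<^sub>R d))) (at (x + t *\<^sub>R d))"
      using GDERIV_grad[OF assms] by (simp add: gderiv_def)
  qed
  moreover have "(\<lambda>s. (s *\<^sub>R d) \<bullet> grad f (x + t *\<^sub>R d)) = (*) (grad f (x + t *\<^sub>R d) \<bullet> d)"
    by (auto simp: inner_commute)
  ultimately show ?thesis
    by (simp add: has_field_derivative_def)
qed

lemma convex_above_tangent:
  fixes f :: "'a::euclidean_space \<Rightarrow> real"
  assumes "convex_on UNIV f" and "f differentiable (at x)"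
  shows "f x + grad f x \<bullet> (z - x) \<le> f z"
proof -
  have "convex_on UNIV (\<lambda>t. f (x + t *\<^sub>R (z - x)))"
  proof (rule convex_onI)
    fix t a b :: real
    assume "0 < t" "t < 1"
    then have "f ((1 - t) *\<^sub>R (x + a *\<^sub>R (z - x)) + t *\<^sub>R (x + b *\<^sub>R (z - x)))
        \<le> (1 - t) * f (x + a *\<^sub>R (z - x)) + t * f (x + b *\<^sub>R (z - x))"
      by (intro convex_onD[OF assms(1)]) auto
    then show "f (x + ((1 - t) *\<^sub>R a + t *\<^sub>R b) *\<^sub>R (z - x))
        \<le> (1 - t) * f (x + a *\<^sub>R (z - x)) + t * f (x + b *\<^sub>R (z - x))"
      by (simp add: algebra_simps)
  qed simp
  moreover have "((\<lambda>t. f (x + t *\<^sub>R (z - x))) has_real_derivative grad f x \<bullet> (z - x)) (at 0)"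
    using DERIV_along_line[of f x 0 "z - x"] assms(2) by simp
  ultimately have "f (x + 1 *\<^sub>R (z - x)) - f (x + 0 *\<^sub>R (z - x)) \<ge> grad f x \<bullet> (z - x) * (1 - 0)"
    by (intro convex_on_imp_above_tangent[of UNIV]) auto
  then show ?thesis by simp
qed

text \<open>A negative slope at \<open>t\<close> would make \<open>f\<close> decrease immediately to
  the right. Minimality is asked for only on that side, so the result covers both the start of a
  segment and the end of a line search that stops short of its cap.\<close>

lemma line_min_imp_grad_nonneg:
  fixes f :: "'a::euclidean_space \<Rightarrow> real"
  assumes "f differentiable (at (x + t *\<^sub>R d))" and "t < u"
    and min: "\<And>s. t < s \<Longrightarrow> s \<le> u \<Longrightarrow> f (x + t *\<^sub>R d) \<le> f (x + s *\<^sub>R d)"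
  shows "0 \<le> grad f (x + t *\<^sub>R d) \<bullet> d"
proof (rule ccontr)
  assume "\<not> ?thesis"
  then obtain e where "e > 0" and e: "\<forall>h>0. h < e \<longrightarrow> f (x + t *\<^sub>R d) > f (x + (t + h) *\<^sub>R d)"
    using DERIV_neg_dec_right[OF DERIV_along_line[OF assms(1)]] by auto
  define h where "h = min (e / 2) (u - t)"
  have "h > 0" "h < e" "t + h \<le> u"
    using \<open>e > 0\<close> \<open>t < u\<close> by (auto simp: h_def)
  then show False
    using e min[of "t + h"] by force
qed

lemma convex_min_imp_grad_nonneg:
  fixes f :: "'a::euclidean_space \<Rightarrow> real"
  assumes "convex S" "f differentiable (at x)" "x \<in> S" "z \<in> S"
    and min: "\<And>z. z \<in> S \<Longrightarrow> f x \<le> f z"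
  shows "0 \<le> grad f x \<bullet> (z - x)"
proof -
  have "x + s *\<^sub>R (z - x) \<in> S" if "0 < s" "s \<le> 1" for s
  proof -
    have "x + s *\<^sub>R (z - x) = (1 - s) *\<^sub>R x + s *\<^sub>R z"
      by (simp add: algebra_simps)
    then show ?thesis
      using convexD[OF assms(1,3,4), of "1 - s" s] that by simp
  qed
  then show ?thesis
    using line_min_imp_grad_nonneg[of f x 0 "z - x" 1] assms(2) min by simp
qed

section \<open>Polyhedral error bounds and linear programming duality\<close>

text \<open>Hoffman's bound. If \<open>p\<close> is the projection of \<open>y\<close>, the direction of \<open>y - p\<close> lies in the
  compact set of unit vectors polar to the polar cone of the constraints active at \<open>p\<close>.
  On this set the maximum of the active constraints is positive, hence bounded away from 0, and
  only finitely many active sets occur.\<close>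

lemma active_constraint_bound:
  fixes a :: "'i \<Rightarrow> 'a::euclidean_space"
  assumes "finite J"
  shows "\<exists>c>0. \<forall>u. norm u = 1 \<longrightarrow> (\<forall>z. (\<forall>i\<in>J. a i \<bullet> z \<le> 0) \<longrightarrow> u \<bullet> z \<le> 0) \<longrightarrow>
           (\<exists>i\<in>J. c \<le> a i \<bullet> u)"
proof -
  define U where "U = {u. norm u = 1 \<and> (\<forall>z. (\<forall>i\<in>J. a i \<bullet> z \<le> 0) \<longrightarrow> u \<bullet> z \<le> 0)}"
  have pos: "\<exists>i\<in>J. 0 < a i \<bullet> u" if "u \<in> U" for u
  proof (rule ccontr)
    assume "\<not> ?thesis"
    \<comment> \<open>All \<open>a i \<bullet> u\<close> being nonpositive, \<open>z = u\<close> is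
      admissible in the definition of \<open>U\<close>.\<close>
    then have "u \<bullet> u \<le> 0"
      using that by (force simp: U_def)
    then have "norm u = 0"
      by (simp add: dot_square_norm)
    then show False
      using that by (simp add: U_def)
  qed
  have "U = sphere 0 1 \<inter> (\<Inter>z\<in>{z. \<forall>i\<in>J. a i \<bullet> z \<le> 0}. {u. z \<bullet> u \<le> 0})"
    by (auto simp: U_def inner_commute)
  then have "compact U"
    by (simp add: compact_Int_closed closed_halfspace_le closed_INT)
  have "\<exists>c>0. \<forall>u\<in>U. \<exists>i\<in>J. c \<le> a i \<bullet> u"
  proof (cases "U = {}")
    case True
    then show ?thesis by (intro exI[of _ 1]) auto
  next
    case False
    then have "J \<noteq> {}"
      using pos by blast
    define m where "m = (\<lambda>u. Max ((\<lambda>i. a i \<bullet> u) ` J))"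
    have cont: "continuous_on U (\<lambda>u. Max ((\<lambda>i. a i \<bullet> u) ` J))"
      using \<open>finite J\<close> \<open>J \<noteq> {}\<close>
    proof (induction J rule: finite_ne_induct)
      case (insert i J)
      then show ?case
        by (simp, intro continuous_intros)
    qed (auto intro: continuous_intros)
    obtain u where "u \<in> U" and u: "\<forall>u'\<in>U. m u \<le> m u'"
      using continuous_attains_inf[OF \<open>compact U\<close> False cont] by (auto simp: m_def)
    have m_ex: "\<exists>i\<in>J. m u = a i \<bullet> u" for u
    proof -
      have "Max ((\<lambda>i. a i \<bullet> u) ` J) \<in> (\<lambda>i. a i \<bullet> u) ` J"
        using \<open>finite J\<close> \<open>J \<noteq> {}\<close> by (intro Max_in) auto
      then show ?thesis
        by (auto simp: m_def)
    qed
    have "m u > 0"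
      using pos[OF \<open>u \<in> U\<close>] \<open>finite J\<close> \<open>J \<noteq> {}\<close> by (auto simp: m_def Max_gr_iff)
    then show ?thesis
      using u m_ex by metis
  qed
  then show ?thesis
    by (auto simp: U_def)
qed

lemma closed_polyhedral_system:
  fixes a :: "'i \<Rightarrow> 'a::euclidean_space"
  shows "closed {y. \<forall>i\<in>I. a i \<bullet> y \<le> b i}" and "convex {y. \<forall>i\<in>I. a i \<bullet> y \<le> b i}"
proof -
  have eq: "{y. \<forall>i\<in>I. a i \<bullet> y \<le> b i} = (\<Inter>i\<in>I. {y. a i \<bullet> y \<le> b i})" by auto
  show "closed {y. \<forall>i\<in>I. a i \<bullet> y \<le> b i}"
    unfolding eq by (intro closed_INT ballI closed_halfspace_le)
  show "convex {y. \<forall>i\<in>I. a i \<bullet> y \<le> b i}"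
    unfolding eq by (intro convex_INT convex_halfspace_le)
qed

text \<open>Constraints active at \<open>p\<close> do not increase along \<open>z\<close>, and a
  short enough step does not use up the slack of the inactive ones; finitely many constraints leave
  a common step length.\<close>

lemma small_step_feasible:
  fixes a :: "'i \<Rightarrow> 'a::real_inner"
  assumes "finite I" and "\<And>i. i \<in> I \<Longrightarrow> a i \<bullet> p \<le> b i"
    and z: "\<And>i. i \<in> I \<Longrightarrow> a i \<bullet> p = b i \<Longrightarrow> a i \<bullet> z \<le> 0"
  shows "\<exists>e>0. \<forall>i\<in>I. a i \<bullet> (p + e *\<^sub>R z) \<le> b i"
proof -
  have "\<forall>\<^sub>F e in at_right (0::real). a i \<bullet> (p + e *\<^sub>R z) \<le> b i" if "i \<in> I" for i
  proof (cases "a i \<bullet> p = b i")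
    case True
    have "a i \<bullet> (p + e *\<^sub>R z) \<le> b i" if "e > 0" for e
      using z[OF \<open>i \<in> I\<close> True] True that by (simp add: inner_add_right mult_le_0_iff)
    then show ?thesis
      using eventually_at_right_less[of "0::real"] by (rule eventually_mono[rotated])
  next
    case False
    have "((\<lambda>e. a i \<bullet> (p + e *\<^sub>R z)) \<longlongrightarrow> a i \<bullet> (p + 0 *\<^sub>R z)) (at_right 0)"
      by (intro tendsto_intros)
    moreover have "a i \<bullet> (p + 0 *\<^sub>R z) < b i"
      using False assms(2)[OF that] by simp
    ultimately show ?thesis
      by (auto dest!: order_tendstoD(2)[of _ _ _ "b i"] simp del: inner_simps elim!: eventually_mono)
  qed
  then have "\<forall>\<^sub>F e in at_right (0::real). 0 < e \<and> (\<forall>i\<in>I. a i \<bullet> (p + e *\<^sub>R z) \<le> b i)"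
    using \<open>finite I\<close> by (simp add: eventually_conj_iff eventually_ball_finite_distrib eventually_at_right_less)
  then show ?thesis
    using eventually_happens'[OF trivial_limit_at_right_real] by blast
qed

lemma hoffman_error_bound:
  fixes a :: "'i \<Rightarrow> 'a::euclidean_space"
  assumes "finite I" and ne: "{y. \<forall>i\<in>I. a i \<bullet> y \<le> b i} \<noteq> {}" (is "?P \<noteq> {}")
  shows "\<exists>c>0. \<forall>y. y \<notin> ?P \<longrightarrow> (\<exists>i\<in>I. c * infdist y ?P \<le> a i \<bullet> y - b i)"
proof -
  have "\<exists>C. \<forall>J. J \<subseteq> I \<longrightarrow> 0 < C J \<and> (\<forall>u. norm u = 1 \<longrightarrow>
          (\<forall>z. (\<forall>i\<in>J. a i \<bullet> z \<le> 0) \<longrightarrow> u \<bullet> z \<le> 0) \<longrightarrow> (\<exists>i\<in>J. C J \<le> a i \<bullet> u))"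
  proof (intro choice allI)
    fix J
    show "\<exists>c. J \<subseteq> I \<longrightarrow> 0 < c \<and> (\<forall>u. norm u = 1 \<longrightarrow>
          (\<forall>z. (\<forall>i\<in>J. a i \<bullet> z \<le> 0) \<longrightarrow> u \<bullet> z \<le> 0) \<longrightarrow> (\<exists>i\<in>J. c \<le> a i \<bullet> u))"
      using active_constraint_bound[of J a] finite_subset[OF _ \<open>finite I\<close>] by blast
  qed
  then obtain C where C_pos: "\<And>J. J \<subseteq> I \<Longrightarrow> 0 < C J" and C: "\<And>J u. J \<subseteq> I \<Longrightarrow> norm u = 1 \<Longrightarrow>
      (\<And>z. (\<forall>i\<in>J. a i \<bullet> z \<le> 0) \<Longrightarrow> u \<bullet> z \<le> 0) \<Longrightarrow> \<exists>i\<in>J. C J \<le> a i \<bullet> u"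
    by metis
  \<comment> \<open>The active set \<open>J\<close> varies with the projected point; the minimum
    over all subsets of \<open>I\<close> makes the constant uniform.\<close>
  define c where "c = Min (C ` Pow I)"
  have "c > 0"
    using \<open>finite I\<close> C_pos by (subst c_def, subst Min_gr_iff) auto
  have "\<exists>i\<in>I. c * infdist y ?P \<le> a i \<bullet> y - b i" if "y \<notin> ?P" for y
  proof -
    define p where "p = closest_point ?P y"
    define J where "J = {i\<in>I. a i \<bullet> p = b i}"
    define u where "u = (1 / norm (y - p)) *\<^sub>R (y - p)"
    have "p \<in> ?P"
      unfolding p_def by (rule closest_point_in_set[OF closed_polyhedral_system(1) ne])
    then have "y \<noteq> p"
      using that by auto
    then have u: "norm u = 1" "y - p = norm (y - p) *\<^sub>R u" and "norm (y - p) > 0"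
      by (simp_all add: u_def)
    have "u \<bullet> z \<le> 0" if "\<forall>i\<in>J. a i \<bullet> z \<le> 0" for z
    proof -
      have "\<exists>e>0. \<forall>i\<in>I. a i \<bullet> (p + e *\<^sub>R z) \<le> b i"
        using \<open>p \<in> ?P\<close> that by (intro small_step_feasible[OF \<open>finite I\<close>]) (auto simp: J_def)
      then obtain e where e: "e > 0" "\<forall>i\<in>I. a i \<bullet> (p + e *\<^sub>R z) \<le> b i" by blast
      \<comment> \<open>The variational inequality for the projection \<open>p\<close>, tested with
        a feasible point, shows that \<open>u\<close> meets the polarity condition that
        \<open>C\<close> requires.\<close>
      then have "(y - p) \<bullet> ((p + e *\<^sub>R z) - p) \<le> 0"
        unfolding p_def
        by (intro closest_point_dot closed_polyhedral_system) auto
      then have "(y - p) \<bullet> z \<le> 0"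
        using e(1) by (simp add: mult_le_0_iff)
      then show ?thesis
        by (simp add: u_def divide_le_0_iff)
    qed
    then obtain i where "i \<in> J" and i: "C J \<le> a i \<bullet> u"
      using C[of J u] u(1) by (auto simp: J_def)
    have "c \<le> C J"
      using \<open>finite I\<close> by (auto simp: c_def J_def intro!: Min_le)
    have "c * infdist y ?P \<le> c * norm (y - p)"
      using infdist_le[OF \<open>p \<in> ?P\<close>, of y] \<open>c > 0\<close> by (simp add: dist_norm)
    also have "\<dots> \<le> (a i \<bullet> u) * norm (y - p)"
      using \<open>c \<le> C J\<close> i by (intro mult_right_mono) auto
    also have "\<dots> = a i \<bullet> (norm (y - p) *\<^sub>R u)"
      by simp
    also have "\<dots> = a i \<bullet> y - b i"
      using \<open>i \<in> J\<close> by (simp add: u(2)[symmetric] inner_diff_right J_def)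
    finally show ?thesis
      using \<open>i \<in> J\<close> by (auto simp: J_def)
  qed
  then show ?thesis
    using \<open>c > 0\<close> by blast
qed

text \<open>Linear programming duality: the cone \<open>K\<close> spanned by the pairs
  \<open>(T (x - p), g \<bullet> (x - p))\<close> is closed because \<open>S\<close> is a polytope,
  and optimality of \<open>p\<close> keeps \<open>(0, -1)\<close> out of it. A separating
  hyperplane, rescaled so that the coefficient of the objective is 1, gives the multiplier.\<close>

lemma polytope_multiplier_exists:
  fixes T :: "'a::euclidean_space \<Rightarrow> 'b::euclidean_space"
  assumes "polytope S" "linear T" "p \<in> S" "T p = 0"
    and opt: "\<And>x. x \<in> S \<Longrightarrow> T x = 0 \<Longrightarrow> 0 \<le> g \<bullet> (x - p)"
  shows "\<exists>y. \<forall>x\<in>S. 0 \<le> g \<bullet> (x - p) + y \<bullet> T x"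
proof -
  define F where "F = (\<lambda>x. (T x, g \<bullet> x))"
  define K where "K = conic hull (F ` ((\<lambda>x. x - p) ` S))"
  have lin: "linear F"
    using \<open>linear T\<close> unfolding F_def
    by (intro linearI) (auto simp: linear_add linear_scale inner_add_right)
  have "polytope ((\<lambda>x. x - p) ` S)"
    using polytope_translation_eq[of "- p" S] \<open>polytope S\<close> by (simp add: algebra_simps)
  then have pt: "polytope (F ` ((\<lambda>x. x - p) ` S))"
    by (rule polytope_linear_image[OF lin])
  have K: "closed K" "convex K"
    using pt by (auto simp: K_def closed_conic_hull_strong convex_conic_hull polytope_imp_convex)
  have K_eq: "K = {c *\<^sub>R F (x - p) | c x. 0 \<le> c \<and> x \<in> S}"
    unfolding K_def conic_hull_explicit by blast
  have "(0, -1) \<notin> K"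
  proof
    assume "(0, -1) \<in> K"
    then obtain c x where c: "0 \<le> c" "x \<in> S" "c *\<^sub>R T (x - p) = 0" "c * (g \<bullet> (x - p)) = -1"
      unfolding K_eq F_def by fastforce
    then have "T x = 0"
      using \<open>linear T\<close> \<open>T p = 0\<close> by (auto simp: linear_diff)
    then have "0 \<le> c * (g \<bullet> (x - p))"
      by (intro mult_nonneg_nonneg opt c)
    then show False
      using c by simp
  qed
  then obtain w \<beta> where w: "w \<bullet> (0, -1) < \<beta>" "\<And>z. z \<in> K \<Longrightarrow> w \<bullet> z > \<beta>"
    using separating_hyperplane_closed_point[OF K(2,1)] by blast
  obtain y \<tau> where w_eq: "w = (y, \<tau>)" by (cases w)
  have "F (p - p) \<in> K"
    unfolding K_eq using \<open>p \<in> S\<close> by (intro CollectI exI[of _ 1] exI[of _ p]) auto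
  \<comment> \<open>The origin lies in \<open>K\<close>, which forces \<beta> to be negative and
    hence the coefficient \<tau> of the objective to be positive.\<close>
  then have "\<beta> < 0"
    using w(2)[of "F (p - p)"] lin by (simp add: linear_0)
  then have "\<tau> > 0"
    using w(1) by (simp add: w_eq)
  have ge: "0 \<le> \<tau> * (g \<bullet> (x - p)) + y \<bullet> T x" if "x \<in> S" for x
  proof (rule ccontr)
    define r where "r = \<tau> * (g \<bullet> (x - p)) + y \<bullet> T x"
    assume "\<not> ?thesis"
    then have "r < 0" by (simp add: r_def)
    \<comment> \<open>On this multiple the separating functional takes exactly the value \<beta>,
      against the strict inequality on \<open>K\<close>.\<close>
    define c where "c = \<beta> / r"
    have "c *\<^sub>R F (x - p) \<in> K"
      unfolding K_eq using that \<open>r < 0\<close> \<open>\<beta> < 0\<close>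
      by (intro CollectI exI[of _ c] exI[of _ x]) (auto simp: c_def divide_nonpos_neg)
    then have "w \<bullet> (c *\<^sub>R F (x - p)) > \<beta>"
      by (rule w(2))
    moreover have "w \<bullet> (c *\<^sub>R F (x - p)) = c * r"
      using \<open>T p = 0\<close> \<open>linear T\<close> by (simp add: w_eq F_def r_def linear_diff algebra_simps)
    ultimately show False
      using \<open>r < 0\<close> by (simp add: c_def)
  qed
  have "0 \<le> g \<bullet> (x - p) + ((1 / \<tau>) *\<^sub>R y) \<bullet> T x" if "x \<in> S" for x
    using ge[OF that] \<open>\<tau> > 0\<close> by (simp add: field_simps)
  then show ?thesis by blast
qed

section \<open>The away-step Frank--Wolfe loop\<close>

text \<open>Inactive weights are 0. The active set changes during a step, so it is convenient to
  compute over a fixed finite superset.\<close>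

lemma sum_over_active:
  fixes w :: "'a::real_vector \<Rightarrow> real"
  assumes "finite T" "\<And>v. 0 \<le> w v" "\<And>v. 0 < w v \<Longrightarrow> v \<in> T"
  shows "(\<Sum>v | 0 < w v. w v) = (\<Sum>v\<in>T. w v)"
    and "(\<Sum>v | 0 < w v. w v *\<^sub>R v) = (\<Sum>v\<in>T. w v *\<^sub>R v)"
proof -
  have sub: "{v. 0 < w v} \<subseteq> T"
    using assms(3) by blast
  have "w v = 0" if "\<not> 0 < w v" for v
    using that assms(2)[of v] by simp
  then show "(\<Sum>v | 0 < w v. w v) = (\<Sum>v\<in>T. w v)"
    and "(\<Sum>v | 0 < w v. w v *\<^sub>R v) = (\<Sum>v\<in>T. w v *\<^sub>R v)"
    by (fastforce intro!: sum.mono_neutral_left[OF \<open>finite T\<close> sub])+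
qed

lemma valid_stateI:
  assumes "finite T" "\<And>v. 0 \<le> w v" "\<And>v. 0 < w v \<Longrightarrow> v \<in> T" "\<And>v. 0 < w v \<Longrightarrow> v extreme_point_of X"
    and "(\<Sum>v\<in>T. w v) = 1" "(\<Sum>v\<in>T. w v *\<^sub>R v) = x"
  shows "valid_state X (x, w)"
  using assms finite_subset[of "{v. 0 < w v}" T] sum_over_active[of T w]
  by (auto simp: valid_state_def)

lemma valid_stateD:
  assumes "valid_state X (x, w)" "finite T" "\<And>v. 0 < w v \<Longrightarrow> v \<in> T"
  shows "(\<Sum>v\<in>T. w v) = 1" "(\<Sum>v\<in>T. w v *\<^sub>R v) = x"
  using assms sum_over_active[of T w] by (auto simp: valid_state_def)

lemma valid_state_mem:
  assumes "convex X" "valid_state X (x, w)"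
  shows "x \<in> X"
proof -
  have "(\<Sum>v | 0 < w v. w v *\<^sub>R v) \<in> X"
    using assms by (intro convex_sum) (auto simp: valid_state_def extreme_point_of_def)
  then show ?thesis
    using assms(2) by (simp add: valid_state_def)
qed

lemma valid_state_vertex:
  assumes "x extreme_point_of X"
  shows "valid_state X (x, \<lambda>v. if v = x then 1 else 0)"
  by (rule valid_stateI[of "{x}"]) (use assms in \<open>auto split: if_splits\<close>)

lemma afw_step_valid:
  assumes "afw_step X \<phi> st \<gamma> \<gamma>\<^sub>m st'" "valid_state X st"
  shows "valid_state X st'"
  using assms
proof (induction rule: afw_step.induct)
  case (frank_wolfe s x w v \<gamma>\<^sub>m \<gamma>)
  \<comment> \<open>The old active set with \<open>s\<close> added contains the new one, even if a
    full step \<open>\<gamma> = 1\<close> drops all other vertices.\<close>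
  let ?T = "insert s {v. 0 < w v}"
  have \<gamma>: "0 \<le> \<gamma>" "\<gamma> \<le> 1"
    using frank_wolfe.hyps by (auto simp: is_arg_min_def)
  have w: "\<And>v. 0 \<le> w v" "finite {v. 0 < w v}" "\<And>v. 0 < w v \<Longrightarrow> v extreme_point_of X"
    using frank_wolfe.prems by (auto simp: valid_state_def)
  note sums = valid_stateD[OF frank_wolfe.prems, of ?T]
  show ?case
  proof (rule valid_stateI[of ?T])
    show "0 \<le> (1 - \<gamma>) * w u + (if u = s then \<gamma> else 0)" for u
      using w(1)[of u] \<gamma> by auto
    have pos: "0 < w u" if "0 < (1 - \<gamma>) * w u + (if u = s then \<gamma> else 0)" "u \<noteq> s" for u
      using that w(1)[of u] by (auto simp: zero_less_mult_iff order_less_le)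
    show "u \<in> ?T" if "0 < (1 - \<gamma>) * w u + (if u = s then \<gamma> else 0)" for u
      using pos[OF that] by blast
    show "u extreme_point_of X" if "0 < (1 - \<gamma>) * w u + (if u = s then \<gamma> else 0)" for u
      using pos[OF that] w(3) frank_wolfe.hyps(1) by blast
    have "(\<Sum>u\<in>?T. (1 - \<gamma>) * w u + (if u = s then \<gamma> else 0))
        = (1 - \<gamma>) * (\<Sum>u\<in>?T. w u) + (\<Sum>u\<in>?T. if u = s then \<gamma> else 0)"
      by (simp only: sum.distrib sum_distrib_left)
    also have "\<dots> = 1"
      using sums w(2) by (subst sum.delta) auto
    finally show "(\<Sum>u\<in>?T. (1 - \<gamma>) * w u + (if u = s then \<gamma> else 0)) = 1" .
    have "(\<Sum>u\<in>?T. ((1 - \<gamma>) * w u + (if u = s then \<gamma> else 0)) *\<^sub>R u)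
        = (\<Sum>u\<in>?T. (1 - \<gamma>) *\<^sub>R w u *\<^sub>R u + (if u = s then \<gamma> *\<^sub>R s else 0))"
      by (intro sum.cong) (auto simp: algebra_simps)
    also have "\<dots> = (1 - \<gamma>) *\<^sub>R (\<Sum>u\<in>?T. w u *\<^sub>R u) + (\<Sum>u\<in>?T. if u = s then \<gamma> *\<^sub>R s else 0)"
      by (simp only: sum.distrib scaleR_sum_right)
    also have "\<dots> = (1 - \<gamma>) *\<^sub>R x + \<gamma> *\<^sub>R s"
      using sums w(2) by (subst sum.delta) auto
    finally show "(\<Sum>u\<in>?T. ((1 - \<gamma>) * w u + (if u = s then \<gamma> else 0)) *\<^sub>R u) = x + \<gamma> *\<^sub>R (s - x)"
      by (simp add: algebra_simps)
  qed (use w in auto)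
next
  case (away s x w v \<gamma>\<^sub>m \<gamma>)
  let ?T = "{v. 0 < w v}"
  have w: "\<And>v. 0 \<le> w v" "finite ?T" "\<And>v. 0 < w v \<Longrightarrow> v extreme_point_of X"
    using away.prems by (auto simp: valid_state_def)
  note sums = valid_stateD[OF away.prems w(2)]
  have "0 < w v"
    using away.hyps by (auto simp: is_arg_max_def)
  have "w v \<le> 1"
    using member_le_sum[of v ?T w] \<open>0 < w v\<close> w sums by simp
  have \<gamma>: "0 \<le> \<gamma>" "\<gamma> \<le> w v / (1 - w v)"
    using away.hyps by (auto simp: is_arg_min_def)
  \<comment> \<open>For \<open>w v = 1\<close> the expression equals 1; otherwise the cap on
    \<gamma> says exactly that the weight of \<open>v\<close> stays nonnegative.\<close>
  have nonneg: "0 \<le> (1 + \<gamma>) * w v - \<gamma>"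
  proof (cases "w v = 1")
    case False
    then have "\<gamma> * (1 - w v) \<le> w v"
      using \<gamma>(2) \<open>w v \<le> 1\<close> by (simp add: field_simps)
    then show ?thesis by (simp add: algebra_simps)
  qed (use \<gamma> in auto)
  show ?case
  proof (rule valid_stateI[of ?T])
    show "0 \<le> (1 + \<gamma>) * w u - (if u = v then \<gamma> else 0)" for u
      using w(1)[of u] \<gamma>(1) nonneg by auto
    have pos: "0 < w u" if "0 < (1 + \<gamma>) * w u - (if u = v then \<gamma> else 0)" for u
      using that w(1)[of u] \<gamma>(1) by (cases "w u = 0") (auto simp: order_less_le split: if_splits)
    show "u \<in> ?T" if "0 < (1 + \<gamma>) * w u - (if u = v then \<gamma> else 0)" for u
      using pos[OF that] by blast
    show "u extreme_point_of X" if "0 < (1 + \<gamma>) * w u - (if u = v then \<gamma> else 0)" for u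
      using pos[OF that] w(3) by blast
    have "(\<Sum>u\<in>?T. (1 + \<gamma>) * w u - (if u = v then \<gamma> else 0))
        = (1 + \<gamma>) * (\<Sum>u\<in>?T. w u) - (\<Sum>u\<in>?T. if u = v then \<gamma> else 0)"
      by (simp only: sum_subtractf sum_distrib_left)
    also have "\<dots> = 1"
      using sums w(2) \<open>0 < w v\<close> by (subst sum.delta) auto
    finally show "(\<Sum>u\<in>?T. (1 + \<gamma>) * w u - (if u = v then \<gamma> else 0)) = 1" .
    have "(\<Sum>u\<in>?T. ((1 + \<gamma>) * w u - (if u = v then \<gamma> else 0)) *\<^sub>R u)
        = (\<Sum>u\<in>?T. (1 + \<gamma>) *\<^sub>R w u *\<^sub>R u - (if u = v then \<gamma> *\<^sub>R v else 0))"
      by (intro sum.cong) (auto simp: algebra_simps)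
    also have "\<dots> = (1 + \<gamma>) *\<^sub>R (\<Sum>u\<in>?T. w u *\<^sub>R u) - (\<Sum>u\<in>?T. if u = v then \<gamma> *\<^sub>R v else 0)"
      by (simp only: sum_subtractf scaleR_sum_right)
    also have "\<dots> = (1 + \<gamma>) *\<^sub>R x - \<gamma> *\<^sub>R v"
      using sums w(2) \<open>0 < w v\<close> by (subst sum.delta) auto
    finally show "(\<Sum>u\<in>?T. ((1 + \<gamma>) * w u - (if u = v then \<gamma> else 0)) *\<^sub>R u) = x + \<gamma> *\<^sub>R (x - v)"
      by (simp add: algebra_simps)
  qed (use w in auto)
qed

lemma afw_loop_valid:
  assumes "afw_loop X \<phi> st st'" "valid_state X st"
  shows "valid_state X st'"
  using assms by (induction rule: afw_loop.induct) (auto dest: afw_step_valid)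

text \<open>Both kinds of step reduce to one direction \<open>d\<close> whose descent slope is at
  least the Frank-Wolfe gap: an away step is taken only when its slope is the larger one. In an away
  step \<gamma> can exceed 1, so \<open>\<gamma> * norm d\<close> is bounded as the distance between
  two points of \<open>X\<close>.\<close>

lemma afw_step_direction:
  assumes "afw_step X \<phi> (x, w) \<gamma> \<gamma>\<^sub>m (x', w')" "valid_state X (x, w)" "convex X" "bounded X"
  obtains d where "x' = x + \<gamma> *\<^sub>R d" "0 \<le> \<gamma>" "norm d \<le> diameter X" "\<gamma> * norm d \<le> diameter X"
    "\<And>z. z \<in> X \<Longrightarrow> grad \<phi> x \<bullet> (x - z) \<le> - (grad \<phi> x \<bullet> d)"
    "\<And>\<beta>. 0 \<le> \<beta> \<Longrightarrow> \<beta> \<le> \<gamma>\<^sub>m \<Longrightarrow> \<phi> x' \<le> \<phi> (x + \<beta> *\<^sub>R d)"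
proof -
  have x: "x \<in> X"
    by (rule valid_state_mem[OF assms(3,2)])
  have x': "x' \<in> X"
    by (rule valid_state_mem[OF assms(3) afw_step_valid[OF assms(1,2)]])
  have diam: "norm (u - v) \<le> diameter X" if "u \<in> X" "v \<in> X" for u v
    using diameter_bounded_bound[OF \<open>bounded X\<close> that] by (simp add: dist_norm)
  have bound: "\<gamma> * norm d \<le> diameter X" if "x' = x + \<gamma> *\<^sub>R d" "0 \<le> \<gamma>" for d
    using diam[OF x' x] that by simp
  from assms(1) show thesis
  proof (cases rule: afw_step.cases)
    case (frank_wolfe s v)
    have s: "s \<in> X" "\<And>z. z \<in> X \<Longrightarrow> grad \<phi> x \<bullet> s \<le> grad \<phi> x \<bullet> z"
      using frank_wolfe by (auto simp: is_arg_min_def not_less)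
    show thesis
    proof (rule that[of "s - x"])
      show "0 \<le> \<gamma>"
        using frank_wolfe by (auto simp: is_arg_min_def)
      then show "\<gamma> * norm (s - x) \<le> diameter X"
        using frank_wolfe by (intro bound) auto
      show "grad \<phi> x \<bullet> (x - z) \<le> - (grad \<phi> x \<bullet> (s - x))" if "z \<in> X" for z
        using s(2)[OF that] by (simp add: inner_diff_right)
      show "\<phi> x' \<le> \<phi> (x + \<beta> *\<^sub>R (s - x))" if "0 \<le> \<beta>" "\<beta> \<le> \<gamma>\<^sub>m" for \<beta>
        using frank_wolfe that by (auto simp: is_arg_min_def not_less)
    qed (use frank_wolfe diam s x in auto)
  next
    case (away s v)
    have s: "\<And>z. z \<in> X \<Longrightarrow> grad \<phi> x \<bullet> s \<le> grad \<phi> x \<bullet> z"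
      using away by (auto simp: is_arg_min_def not_less)
    have "v \<in> X"
      using away assms(2) by (auto simp: is_arg_max_def valid_state_def extreme_point_of_def)
    show thesis
    proof (rule that[of "x - v"])
      show "0 \<le> \<gamma>"
        using away by (auto simp: is_arg_min_def)
      then show "\<gamma> * norm (x - v) \<le> diameter X"
        using away by (intro bound) auto
      show "grad \<phi> x \<bullet> (x - z) \<le> - (grad \<phi> x \<bullet> (x - v))" if "z \<in> X" for z
        using s[OF that] away by (simp add: inner_diff_right)
      show "\<phi> x' \<le> \<phi> (x + \<beta> *\<^sub>R (x - v))" if "0 \<le> \<beta>" "\<beta> \<le> \<gamma>\<^sub>m" for \<beta>
        using away that by (auto simp: is_arg_min_def not_less)
    qed (use away diam \<open>v \<in> X\<close> x in auto)
  qed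
qed

text \<open>A step that is not cut off at \<open>\<gamma>\<^sub>m\<close> ends where the directional derivative is nonnegative, so
  by smoothness the derivative at its start, and with it the optimality gap, was small.\<close>

lemma afw_loop_gap:
  assumes "afw_loop X \<phi> st st'" "valid_state X st" "convex X" "bounded X"
    and smooth: "L_smooth L \<phi>"
    and tangent: "\<And>x z. \<phi> x + grad \<phi> x \<bullet> (z - x) \<le> \<phi> z"
    and "z \<in> X"
  shows "\<phi> (fst st') - \<phi> z \<le> L * (diameter X)\<^sup>2"
  using assms(1,2)
proof (induction rule: afw_loop.induct)
  case (stop st \<gamma> \<gamma>\<^sub>m st')
  obtain x w x' w' where st: "st = (x, w)" "st' = (x', w')"
    by (cases st, cases st')
  obtain d where d: "x' = x + \<gamma> *\<^sub>R d" "0 \<le> \<gamma>" "norm d \<le> diameter X" "\<gamma> * norm d \<le> diameter X"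
    and gap: "\<And>z. z \<in> X \<Longrightarrow> grad \<phi> x \<bullet> (x - z) \<le> - (grad \<phi> x \<bullet> d)"
    and min: "\<And>\<beta>. 0 \<le> \<beta> \<Longrightarrow> \<beta> \<le> \<gamma>\<^sub>m \<Longrightarrow> \<phi> x' \<le> \<phi> (x + \<beta> *\<^sub>R d)"
    using stop afw_step_direction[OF _ _ \<open>convex X\<close> \<open>bounded X\<close>] unfolding st by metis
  have diff: "\<phi> differentiable (at u)" for u
    using smooth by (simp add: L_smooth_def)
  have lip: "norm (grad \<phi> x' - grad \<phi> x) \<le> L * norm (x' - x)" and "0 \<le> L"
    using smooth lipschitz_on_normD[of L UNIV "grad \<phi>" x' x] lipschitz_on_nonneg
    by (auto simp: L_smooth_def)
  \<comment> \<open>Since \<gamma> lies below the cap, the line search is also minimal against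
    points slightly beyond \<gamma>, so the slope there cannot be negative.\<close>
  have "0 \<le> grad \<phi> x' \<bullet> d"
    unfolding d(1) using min stop.hyps(2) d(1,2) by (intro line_min_imp_grad_nonneg diff) auto
  then have "- (grad \<phi> x \<bullet> d) \<le> (grad \<phi> x' - grad \<phi> x) \<bullet> d"
    by (simp add: inner_diff_left)
  also have "\<dots> \<le> norm (grad \<phi> x' - grad \<phi> x) * norm d"
    by (rule norm_cauchy_schwarz)
  also have "\<dots> \<le> (L * norm (x' - x)) * norm d"
    using lip by (rule mult_right_mono) simp
  also have "\<dots> = L * ((\<gamma> * norm d) * norm d)"
    using d(1,2) by simp
  also have "\<dots> \<le> L * (diameter X * diameter X)"
    using d(2-4) \<open>0 \<le> L\<close> order_trans[OF norm_ge_zero d(3)] by (intro mult_left_mono mult_mono) auto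
  finally have "- (grad \<phi> x \<bullet> d) \<le> L * (diameter X)\<^sup>2"
    by (simp add: power2_eq_square)
  moreover have "\<phi> x' \<le> \<phi> x"
    using min[of 0] stop.hyps(2) d(2) by simp
  moreover have "\<phi> x - \<phi> z \<le> grad \<phi> x \<bullet> (x - z)"
    using tangent[of x z] by (simp add: inner_diff_right)
  ultimately show ?case
    using gap[OF \<open>z \<in> X\<close>] by (simp add: st)
qed (auto dest: afw_step_valid)

section \<open>The augmented Lagrangian and its dual\<close>

lemma matrix_transpose_inner:
  fixes M :: "real^'m^'n"
  shows "(transpose M *v u) \<bullet> z = u \<bullet> (M *v z)"
  by (metis dot_lmul_matrix transpose_matrix_vector)

lemma GDERIV_aug_lagrangian:
  fixes f :: "real^'m::finite \<Rightarrow> real" and M :: "real^'m^'n::finite"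
  assumes "f differentiable (at x)"
  shows "GDERIV (\<lambda>z. aug_lagrangian f M lam z y) x :>
           grad f x + transpose M *v (y + lam *\<^sub>R (M *v x))"
proof -
  have f: "(f has_derivative (\<lambda>h. h \<bullet> grad f x)) (at x)"
    using GDERIV_grad[OF assms] by (simp add: gderiv_def)
  have M: "((\<lambda>z. M *v z) has_derivative (\<lambda>h. M *v h)) (at x)"
    by (intro bounded_linear.has_derivative[OF matrix_vector_mul_bounded_linear] has_derivative_ident)
  have "((\<lambda>z. f z + y \<bullet> (M *v z) + lam / 2 * ((M *v z) \<bullet> (M *v z))) has_derivative
      (\<lambda>h. h \<bullet> grad f x + y \<bullet> (M *v h) + lam / 2 * ((M *v x) \<bullet> (M *v h) + (M *v h) \<bullet> (M *v x)))) (at x)"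
    by (intro has_derivative_add f has_derivative_mult_right has_derivative_inner
        has_derivative_inner_right M)
  moreover have "(\<lambda>h. h \<bullet> grad f x + y \<bullet> (M *v h) + lam / 2 * ((M *v x) \<bullet> (M *v h) + (M *v h) \<bullet> (M *v x)))
      = (\<lambda>h. h \<bullet> (grad f x + transpose M *v (y + lam *\<^sub>R (M *v x))))"
  proof
    fix h
    have "h \<bullet> (transpose M *v (y + lam *\<^sub>R (M *v x))) = y \<bullet> (M *v h) + lam * ((M *v x) \<bullet> (M *v h))"
      using matrix_transpose_inner[of M "y + lam *\<^sub>R (M *v x)" h]
      by (simp add: inner_commute inner_add_left inner_add_right)
    then show "h \<bullet> grad f x + y \<bullet> (M *v h) + lam / 2 * ((M *v x) \<bullet> (M *v h) + (M *v h) \<bullet> (M *v x))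
      = h \<bullet> (grad f x + transpose M *v (y + lam *\<^sub>R (M *v x)))"
      by (simp add: inner_add_right inner_commute[of "M *v h"])
  qed
  ultimately show ?thesis
    by (simp add: gderiv_def aug_lagrangian_def power2_norm_eq_inner)
qed

lemma grad_aug_lagrangian:
  fixes f :: "real^'m::finite \<Rightarrow> real" and M :: "real^'m^'n::finite"
  assumes "f differentiable (at x)"
  shows "grad (\<lambda>z. aug_lagrangian f M lam z y) x = grad f x + transpose M *v (y + lam *\<^sub>R (M *v x))"
  by (rule grad_eqI[OF GDERIV_aug_lagrangian[OF assms]])

lemma differentiable_aug_lagrangian:
  fixes f :: "real^'m::finite \<Rightarrow> real" and M :: "real^'m^'n::finite"
  assumes "f differentiable (at x)"
  shows "(\<lambda>z. aug_lagrangian f M lam z y) differentiable (at x)"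
  using GDERIV_aug_lagrangian[OF assms] unfolding gderiv_def by (rule differentiableI)

lemma L_smooth_aug_lagrangian:
  fixes f :: "real^'m::finite \<Rightarrow> real" and M :: "real^'m^'n::finite"
  assumes "L_smooth L f" and "0 \<le> lam"
  shows "L_smooth (smooth_const L lam M) (\<lambda>z. aug_lagrangian f M lam z y)"
proof -
  have diff: "\<And>x. f differentiable (at x)" and lip: "L-lipschitz_on UNIV (grad f)"
    using assms(1) by (auto simp: L_smooth_def)
  let ?g = "grad (\<lambda>z. aug_lagrangian f M lam z y)"
  have bl: "bounded_linear ((*v) (transpose M ** M))"
    by (rule matrix_vector_mul_bounded_linear)
  have "(smooth_const L lam M)-lipschitz_on UNIV ?g"
  proof (rule lipschitz_onI)
    show "0 \<le> smooth_const L lam M"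
      using lipschitz_on_nonneg[OF lip] onorm_pos_le[OF bl] \<open>0 \<le> lam\<close> by (simp add: smooth_const_def)
    fix u v
    have "?g u - ?g v = (grad f u - grad f v) + lam *\<^sub>R ((transpose M ** M) *v (u - v))"
      by (simp add: grad_aug_lagrangian[OF diff] matrix_vector_right_distrib
          matrix_vector_mult_scaleR matrix_vector_mult_diff_distrib matrix_vector_mul_assoc
          scaleR_diff_right)
    then have "norm (?g u - ?g v) \<le> norm (grad f u - grad f v) + lam * norm ((transpose M ** M) *v (u - v))"
      using norm_triangle_ineq[of "grad f u - grad f v"] \<open>0 \<le> lam\<close> by (metis abs_of_nonneg norm_scaleR)
    also have "\<dots> \<le> L * norm (u - v) + lam * (onorm ((*v) (transpose M ** M)) * norm (u - v))"
      using lipschitz_on_normD[OF lip, of u v] onorm[OF bl] \<open>0 \<le> lam\<close>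
      by (intro add_mono mult_left_mono) auto
    finally show "dist (?g u) (?g v) \<le> smooth_const L lam M * dist u v"
      by (simp add: dist_norm smooth_const_def algebra_simps)
  qed
  then show ?thesis
    using differentiable_aug_lagrangian[OF diff, where M = M and lam = lam and y = y]
    by (simp add: L_smooth_def)
qed

text \<open>The maximiser \<open>h / (2 * C)\<close> of the concave quadratic gives the first term
  when it is at most 1; otherwise the end point \<open>\<gamma> = 1\<close> gives the second, as
  then \<open>C < h / 2\<close>.\<close>

lemma min_quadratic_le_concave_max:
  fixes C h \<delta> :: real
  assumes "0 < C" "0 \<le> h" and \<delta>: "\<And>\<gamma>. 0 \<le> \<gamma> \<Longrightarrow> \<gamma> \<le> 1 \<Longrightarrow> \<gamma> * h - \<gamma>\<^sup>2 * C \<le> \<delta>"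
  shows "min (h\<^sup>2 / (4 * C)) (h / 2) \<le> \<delta>"
proof (cases "h \<le> 2 * C")
  case True
  have "h / (2 * C) * h - (h / (2 * C))\<^sup>2 * C = h\<^sup>2 / (4 * C)"
    using \<open>0 < C\<close> by (simp add: field_simps power2_eq_square)
  then show ?thesis
    using \<delta>[of "h / (2 * C)"] True assms(1,2) by (simp add: min_le_iff_disj)
next
  case False
  then show ?thesis
    using \<delta>[of 1] by (simp add: min_le_iff_disj)
qed

section \<open>Duality and the error bound for the augmented Lagrangian\<close>

locale augmented_problem =
  fixes f :: "real^'m::finite \<Rightarrow> real" and M :: "real^'m^'n::finite" and lam :: real
    and X :: "(real^'m) set"
  assumes convex_f: "convex_on UNIV f"
    and diff_f: "\<And>x. f differentiable (at x)"
    and polytope_X: "polytope X"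
    and feasible: "\<exists>x\<in>X. M *v x = 0"
    and lam_pos: "0 < lam"
begin

abbreviation \<L> :: "real^'m \<Rightarrow> real^'n \<Rightarrow> real" where
  "\<L> \<equiv> aug_lagrangian f M lam"

abbreviation d :: "real^'n \<Rightarrow> real" where
  "d \<equiv> dual_fun f M lam X"

lemma X_facts: "convex X" "compact X" "bounded X" "X \<noteq> {}"
  using polytope_X feasible
  by (auto simp: polytope_imp_convex polytope_imp_compact polytope_imp_bounded)

text \<open>The function \<open>f\<close> obeys its tangent inequality and the quadratic penalty
  expands exactly, leaving a square: strong convexity with respect to the constraint values.\<close>

lemma aug_lower_bound:
  "\<L> x y + grad (\<lambda>z. \<L> z y) x \<bullet> (z - x) + lam / 2 * (norm (M *v z - M *v x))\<^sup>2 \<le> \<L> z y"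
proof -
  have "grad (\<lambda>z. \<L> z y) x \<bullet> (z - x)
      = grad f x \<bullet> (z - x) + (y + lam *\<^sub>R (M *v x)) \<bullet> (M *v z - M *v x)"
    by (simp add: grad_aug_lagrangian[OF diff_f] inner_add_left[of "grad f x"] dot_lmul_matrix
        matrix_vector_mult_diff_distrib)
  also have "\<dots> \<le> f z - f x + (y + lam *\<^sub>R (M *v x)) \<bullet> (M *v z - M *v x)"
    using convex_above_tangent[OF convex_f diff_f, of x z] by simp
  finally show ?thesis
    by (simp add: aug_lagrangian_def power2_norm_eq_inner inner_diff_left inner_diff_right
        inner_add_left inner_add_right inner_commute algebra_simps)
qed

lemma aug_tangent: "\<L> x y + grad (\<lambda>z. \<L> z y) x \<bullet> (z - x) \<le> \<L> z y"
  using aug_lower_bound[of x y z] lam_pos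
  by (smt (verit) zero_le_power2 mult_nonneg_nonneg divide_nonneg_pos)

lemma continuous_aug: "continuous_on S (\<lambda>x. \<L> x y)"
  using differentiable_aug_lagrangian[OF diff_f] differentiable_imp_continuous_within
  by (intro continuous_at_imp_continuous_on) blast

lemma dual_fun_attained: "\<exists>xh\<in>X. \<L> xh y = d y \<and> (\<forall>x\<in>X. \<L> xh y \<le> \<L> x y)"
proof -
  obtain xh where xh: "xh \<in> X" "\<And>x. x \<in> X \<Longrightarrow> \<L> xh y \<le> \<L> x y"
    using continuous_attains_inf[OF X_facts(2,4) continuous_aug] by blast
  then have "d y = \<L> xh y"
    unfolding dual_fun_def by (intro cInf_eq_minimum) auto
  then show ?thesis
    using xh by auto
qed

lemma dual_fun_le: "x \<in> X \<Longrightarrow> d y \<le> \<L> x y"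
  using dual_fun_attained[of y] by auto

lemma dual_fun_gap_quadratic:
  assumes "xh \<in> X" "\<L> xh y = d y" "x \<in> X"
  shows "lam / 2 * (norm (M *v x - M *v xh))\<^sup>2 \<le> \<L> x y - d y"
proof -
  have "0 \<le> grad (\<lambda>z. \<L> z y) xh \<bullet> (x - xh)"
    using assms dual_fun_le differentiable_aug_lagrangian[OF diff_f]
    by (intro convex_min_imp_grad_nonneg[OF X_facts(1)]) auto
  then show ?thesis
    using aug_lower_bound[of xh y x] assms(2) by simp
qed

lemma aug_diff: "\<L> x y' - \<L> x y = (y' - y) \<bullet> (M *v x)"
  by (simp add: aug_lagrangian_def inner_diff_left)

definition smooth_diam :: "real \<Rightarrow> real" where
  "smooth_diam L = smooth_const L lam M * (diameter X)\<^sup>2"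

text \<open>Discarding the contribution of \<open>L\<close> leaves a bound common to all smoothness
  constants, so a constant controlled by it can be chosen before \<open>L\<close>.\<close>

lemma smooth_diam_ge:
  assumes "L_smooth L f"
  shows "lam * (onorm ((*v) (transpose M ** M)) * (diameter X)\<^sup>2) \<le> smooth_diam L"
proof -
  have "0 \<le> L"
    using assms lipschitz_on_nonneg by (auto simp: L_smooth_def)
  then show ?thesis
    by (simp add: smooth_diam_def smooth_const_def algebra_simps)
qed

lemma smooth_diam_nonneg: "L_smooth L f \<Longrightarrow> 0 \<le> smooth_diam L"
  using lam_pos onorm_pos_le[OF matrix_vector_mul_bounded_linear, of "transpose M ** M"]
  by (intro order_trans[OF _ smooth_diam_ge]) simp_all

text \<open>\<open>xs\<close> minimises \<open>f\<close> over the feasible part of \<open>X\<close>;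
  linear programming duality for the linearisation of \<open>f\<close> at \<open>xs\<close> supplies
  \<open>ys\<close>.\<close>

lemma saddle_point:
  obtains xs ys where "xs \<in> X" "M *v xs = 0"
    "\<And>x. x \<in> X \<Longrightarrow> 0 \<le> grad f xs \<bullet> (x - xs) + ys \<bullet> (M *v x)"
proof -
  define F where "F = X \<inter> {x. M *v x = 0}"
  have lin: "linear ((*v) M)" by simp
  have "F \<noteq> {}"
    using feasible by (auto simp: F_def)
  have "closed {x. M *v x = 0}"
    by (rule closed_subspace[OF linear_subspace_kernel[OF lin]])
  then have "compact F"
    unfolding F_def by (rule compact_Int_closed[OF X_facts(2)])
  moreover have "convex F"
    unfolding F_def using X_facts(1) subspace_imp_convex[OF linear_subspace_kernel[OF lin]]
    by (rule convex_Int)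
  ultimately obtain xs where xs: "xs \<in> F" "\<And>x. x \<in> F \<Longrightarrow> \<L> xs 0 \<le> \<L> x 0"
    using continuous_attains_inf[OF _ \<open>F \<noteq> {}\<close> continuous_aug[of F 0]] by blast
  have f_min: "f xs \<le> f x" if "x \<in> F" for x
    using xs(1) xs(2)[OF that] that by (auto simp: F_def aug_lagrangian_def)
  have "0 \<le> grad f xs \<bullet> (x - xs)" if "x \<in> X" "M *v x = 0" for x
    using that xs(1) f_min by (intro convex_min_imp_grad_nonneg[OF \<open>convex F\<close> diff_f]) (auto simp: F_def)
  then have "\<exists>ys. \<forall>x\<in>X. 0 \<le> grad f xs \<bullet> (x - xs) + ys \<bullet> (M *v x)"
    using polytope_multiplier_exists[OF polytope_X lin, of xs "grad f xs"] xs(1) by (auto simp: F_def)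
  then show thesis
    using that xs(1) by (auto simp: F_def)
qed

section \<open>Dual values compared with a feasible primal point\<close>

context
  fixes xs :: "real^'m"
  assumes xs: "xs \<in> X" "M *v xs = 0"
begin

lemma aug_at_feasible: "\<L> xs y = f xs"
  using xs by (simp add: aug_lagrangian_def)

lemma dual_fun_le_feasible: "d y \<le> f xs"
  using dual_fun_le[OF xs(1)] aug_at_feasible by metis

text \<open>As \<open>M *v xs = 0\<close>, the hypothesis is the first-order optimality condition of
  \<open>xs\<close> for the Lagrangian at \<open>y\<close>; by convexity \<open>xs\<close> then
  minimises it over \<open>X\<close>.\<close>

lemma dual_fun_eq_of_multiplier:
  assumes "\<And>x. x \<in> X \<Longrightarrow> 0 \<le> grad f xs \<bullet> (x - xs) + y \<bullet> (M *v x)"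
  shows "d y = f xs"
proof -
  obtain xh where xh: "xh \<in> X" "\<L> xh y = d y"
    using dual_fun_attained by blast
  have "f xs \<le> \<L> xh y"
    using aug_tangent[of xs y xh] assms[OF xh(1)] xs aug_at_feasible[of y]
    by (simp add: grad_aug_lagrangian[OF diff_f] inner_add_left dot_lmul_matrix
        matrix_vector_mult_diff_distrib)
  then show ?thesis
    using xh(2) dual_fun_le_feasible[of y] by simp
qed

text \<open>The dual value is at most the Lagrangian at the point a fraction \<gamma> of the way
  from \<open>xs\<close> to \<open>x\<close>: the slope at \<open>xs\<close> gives the linear gain,
  the Lipschitz gradient the quadratic loss.\<close>

lemma dual_gap_ge:
  assumes smooth: "L_smooth L f" and "x \<in> X" "0 \<le> \<gamma>" "\<gamma> \<le> 1"
  shows "\<gamma> * - (grad f xs \<bullet> (x - xs) + y \<bullet> (M *v x)) - \<gamma>\<^sup>2 * smooth_diam L \<le> f xs - d y"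
proof -
  define u where "u = xs + \<gamma> *\<^sub>R (x - xs)"
  let ?g = "grad (\<lambda>z. \<L> z y)"
  have "u = (1 - \<gamma>) *\<^sub>R xs + \<gamma> *\<^sub>R x"
    by (simp add: u_def algebra_simps)
  then have "u \<in> X"
    using convexD[OF X_facts(1) xs(1) \<open>x \<in> X\<close>, of "1 - \<gamma>" \<gamma>] assms by simp
  have lip: "(smooth_const L lam M)-lipschitz_on UNIV ?g"
    using L_smooth_aug_lagrangian[OF smooth, of lam M y] lam_pos by (simp add: L_smooth_def)
  have "d y \<le> \<L> u y"
    by (rule dual_fun_le[OF \<open>u \<in> X\<close>])
  \<comment> \<open>Convexity is applied at \<open>u\<close>, so that an upper bound for the value
    there needs only a comparison of the gradients at \<open>u\<close> and
    \<open>xs\<close>.\<close>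
  also have "\<dots> \<le> \<L> xs y - ?g u \<bullet> (xs - u)"
    using aug_tangent[of u y xs] by simp
  also have "\<dots> = f xs + \<gamma> * (?g xs \<bullet> (x - xs)) + \<gamma> * ((?g u - ?g xs) \<bullet> (x - xs))"
    by (simp add: aug_at_feasible u_def algebra_simps inner_diff_left)
  finally have 1: "d y \<le> f xs + \<gamma> * (?g xs \<bullet> (x - xs)) + \<gamma> * ((?g u - ?g xs) \<bullet> (x - xs))" .
  have diam: "norm (x - xs) \<le> diameter X"
    using diameter_bounded_bound[OF X_facts(3) \<open>x \<in> X\<close> xs(1)] by (simp add: dist_norm)
  have "(?g u - ?g xs) \<bullet> (x - xs) \<le> norm (?g u - ?g xs) * norm (x - xs)"
    by (rule norm_cauchy_schwarz)
  also have "\<dots> \<le> (smooth_const L lam M * norm (u - xs)) * norm (x - xs)"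
    using lipschitz_on_normD[OF lip, of u xs] by (intro mult_right_mono) auto
  also have "\<dots> = smooth_const L lam M * (\<gamma> * (norm (x - xs))\<^sup>2)"
    using \<open>0 \<le> \<gamma>\<close> by (simp add: u_def power2_eq_square)
  also have "\<dots> \<le> smooth_const L lam M * (\<gamma> * (diameter X)\<^sup>2)"
    using lipschitz_on_nonneg[OF lip] \<open>0 \<le> \<gamma>\<close> diam by (intro mult_left_mono power_mono) auto
  also have "\<dots> = \<gamma> * smooth_diam L"
    by (simp add: smooth_diam_def)
  finally have "\<gamma> * ((?g u - ?g xs) \<bullet> (x - xs)) \<le> \<gamma> * (\<gamma> * smooth_diam L)"
    using \<open>0 \<le> \<gamma>\<close> by (rule mult_left_mono)
  moreover define s where "s = grad f xs \<bullet> (x - xs) + y \<bullet> (M *v x)"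
  have "?g xs \<bullet> (x - xs) = s" unfolding s_def
    using xs by (simp add: grad_aug_lagrangian[OF diff_f] inner_add_left dot_lmul_matrix
        matrix_vector_mult_diff_distrib)
  ultimately show ?thesis
    using 1 unfolding s_def[symmetric] by (simp add: power2_eq_square)
qed

end

lemma dual_opt_facts:
  shows "d y \<le> dual_opt f M lam X"
    and "dual_argmax f M lam X = {y. d y = dual_opt f M lam X}"
    and "dual_argmax f M lam X \<noteq> {}"
    and "x \<in> X \<Longrightarrow> M *v x = 0 \<Longrightarrow> dual_opt f M lam X \<le> f x"
proof -
  obtain xs ys where xs: "xs \<in> X" "M *v xs = 0"
    and ys: "\<And>x. x \<in> X \<Longrightarrow> 0 \<le> grad f xs \<bullet> (x - xs) + ys \<bullet> (M *v x)"
    using saddle_point by blast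
  have max: "d ys = f xs" "\<And>y. d y \<le> f xs"
    using dual_fun_eq_of_multiplier[OF xs ys] dual_fun_le_feasible[OF xs] by auto
  then have opt: "dual_opt f M lam X = f xs"
    unfolding dual_opt_def by (intro cSup_eq_maximum) (metis rangeI, auto)
  show "d y \<le> dual_opt f M lam X"
    by (simp add: opt max)
  show eq: "dual_argmax f M lam X = {y. d y = dual_opt f M lam X}"
    unfolding dual_argmax_def is_arg_max_def opt using max
    by (auto simp: not_less) (metis order_antisym)
  show "dual_argmax f M lam X \<noteq> {}"
    using max(1) by (auto simp: eq opt)
  show "dual_opt f M lam X \<le> f x" if "x \<in> X" "M *v x = 0"
    using dual_fun_le_feasible[OF that, of ys] by (simp add: opt max)
qed

lemma dual_error_bound:
  obtains a where "0 < a" "a \<le> 1"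
    "\<And>L y. L_smooth L f \<Longrightarrow> 0 < smooth_diam L \<Longrightarrow>
       a\<^sup>2 / 2 * min ((infdist y (dual_argmax f M lam X))\<^sup>2 / smooth_diam L)
                   (infdist y (dual_argmax f M lam X))
         \<le> dual_opt f M lam X - d y"
proof -
  define Y where "Y = dual_argmax f M lam X"
  obtain xs ys where xs: "xs \<in> X" "M *v xs = 0"
    and ys: "\<And>x. x \<in> X \<Longrightarrow> 0 \<le> grad f xs \<bullet> (x - xs) + ys \<bullet> (M *v x)"
    using saddle_point by blast
  have opt: "dual_opt f M lam X = f xs"
    using dual_opt_facts(1)[of ys] dual_opt_facts(4)[OF xs] dual_fun_eq_of_multiplier[OF xs ys] by simp
  obtain V where V: "finite V" "X = convex hull V"
    using polytope_X by (auto simp: polytope_def)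
  then have "V \<subseteq> X"
    by (simp add: hull_subset)
  \<comment> \<open>Multipliers satisfying the optimality condition of \<open>xs\<close> at the
    finitely many generators of \<open>X\<close>, which makes the set polyhedral.\<close>
  define P where "P = {y. \<forall>v\<in>V. - (M *v v) \<bullet> y \<le> grad f xs \<bullet> (v - xs)}"
  have P_iff: "y \<in> P \<longleftrightarrow> (\<forall>v\<in>V. 0 \<le> grad f xs \<bullet> (v - xs) + y \<bullet> (M *v v))" for y
    by (simp add: P_def inner_commute algebra_simps)
  have "ys \<in> P"
    using ys \<open>V \<subseteq> X\<close> by (auto simp: P_iff)
  have "P \<subseteq> Y"
  proof
    fix y assume "y \<in> P"
    let ?u = "grad f xs + y v* M"
    have u: "?u \<bullet> x = grad f xs \<bullet> x + y \<bullet> (M *v x)" for x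
      by (simp add: inner_add_left dot_lmul_matrix)
    have "X \<subseteq> {x. ?u \<bullet> x \<ge> grad f xs \<bullet> xs}"
      unfolding V(2) using \<open>y \<in> P\<close>
      by (intro hull_minimal convex_halfspace_ge) (auto simp: P_iff u inner_diff_right)
    then have "0 \<le> grad f xs \<bullet> (x - xs) + y \<bullet> (M *v x)" if "x \<in> X" for x
      using that by (auto simp: u inner_diff_right)
    then show "y \<in> Y"
      using dual_fun_eq_of_multiplier[OF xs] by (simp add: Y_def dual_opt_facts(2) opt)
  qed
  obtain c where "0 < c"
    and c: "\<And>y. y \<notin> P \<Longrightarrow> \<exists>v\<in>V. c * infdist y P \<le> - (M *v v) \<bullet> y - grad f xs \<bullet> (v - xs)"
    using hoffman_error_bound[OF V(1), of "\<lambda>v. - (M *v v)" "\<lambda>v. grad f xs \<bullet> (v - xs)"] \<open>ys \<in> P\<close>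
    unfolding P_def by blast
  \<comment> \<open>The bound \<open>c / 2\<close> gives \<open>2 * (a * r) \<le> h\<close> for the
    quadratic branch below; the cap 1 gives \<open>a\<^sup>2 \<le> a\<close> for the linear
    one.\<close>
  define a where "a = min 1 (c / 2)"
  have a: "0 < a" "a \<le> 1" "a \<le> c / 2"
    using \<open>0 < c\<close> by (auto simp: a_def)
  have "a\<^sup>2 / 2 * min ((infdist y Y)\<^sup>2 / smooth_diam L) (infdist y Y) \<le> f xs - d y"
    if smooth: "L_smooth L f" and pos: "0 < smooth_diam L" for L y
  proof (cases "y \<in> P")
    case True
    then show ?thesis
      using \<open>P \<subseteq> Y\<close> dual_fun_le_feasible[OF xs] by auto
  next
    case False
    define C where "C = smooth_diam L"
    define r where "r = infdist y Y"
    obtain v where "v \<in> V" and v: "c * infdist y P \<le> - (M *v v) \<bullet> y - grad f xs \<bullet> (v - xs)"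
      using c[OF False] by blast
    \<comment> \<open>\<open>h\<close> is the rate of decrease of the Lagrangian at
      \<open>xs\<close> towards the violated generator \<open>v\<close>. It is at least
      \<open>c\<close> times the distance to \<open>P\<close>, hence also \<open>c\<close> times
      that to the larger set \<open>Y\<close>.\<close>
    define h where "h = - (grad f xs \<bullet> (v - xs) + y \<bullet> (M *v v))"
    have "r \<le> infdist y P"
      unfolding r_def using \<open>P \<subseteq> Y\<close> \<open>ys \<in> P\<close> by (intro infdist_mono) auto
    then have "c * r \<le> c * infdist y P"
      using \<open>0 < c\<close> by simp
    then have h: "c * r \<le> h"
      using v by (simp add: h_def inner_commute)
    have r: "0 \<le> r"
      by (simp add: r_def infdist_nonneg)
    have "0 \<le> c * r"
      using r \<open>0 < c\<close> by simp
    have "min (h\<^sup>2 / (4 * C)) (h / 2) \<le> f xs - d y"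
    proof (rule min_quadratic_le_concave_max)
      show "\<gamma> * h - \<gamma>\<^sup>2 * C \<le> f xs - d y" if "0 \<le> \<gamma>" "\<gamma> \<le> 1" for \<gamma>
        unfolding h_def C_def using dual_gap_ge[OF xs smooth _ that] \<open>v \<in> V\<close> \<open>V \<subseteq> X\<close> by blast
    qed (use pos h \<open>0 \<le> c * r\<close> in \<open>auto simp: C_def\<close>)
    moreover have "a\<^sup>2 / 2 * (r\<^sup>2 / C) \<le> h\<^sup>2 / (4 * C)"
    proof -
      have "2 * (a * r)\<^sup>2 \<le> (2 * (a * r))\<^sup>2"
        by (simp add: power_mult_distrib)
      also have "\<dots> \<le> h\<^sup>2"
        using a r h mult_right_mono[OF a(3) r] by (intro power_mono) auto
      finally show ?thesis
        using pos by (simp add: C_def field_simps power_mult_distrib)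
    qed
    moreover have "a\<^sup>2 / 2 * r \<le> h / 2"
    proof -
      have "a\<^sup>2 \<le> a"
        using a by (simp add: power2_eq_square mult_le_one mult_left_le)
      then have "a\<^sup>2 * r \<le> c / 2 * r"
        using a(3) r by (intro mult_right_mono) auto
      then show ?thesis
        using h \<open>0 \<le> c * r\<close> by simp
    qed
    moreover have "a\<^sup>2 / 2 * min (r\<^sup>2 / C) r \<le> a\<^sup>2 / 2 * (r\<^sup>2 / C)"
      and "a\<^sup>2 / 2 * min (r\<^sup>2 / C) r \<le> a\<^sup>2 / 2 * r"
      by (intro mult_left_mono min.cobounded1 min.cobounded2; simp)+
    ultimately have "a\<^sup>2 / 2 * min (r\<^sup>2 / C) r \<le> f xs - d y"
      by linarith
    then show ?thesis
      by (simp add: r_def C_def)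
  qed
  then show thesis
    using that[OF a(1,2)] by (simp add: Y_def opt)
qed

end

section \<open>Rates of convergence\<close>

lemma geometric_rate:
  fixes \<Delta> :: "nat \<Rightarrow> real"
  assumes "0 \<le> \<rho>" and step: "\<And>t. t0 \<le> t \<Longrightarrow> \<Delta> (Suc t) * (1 + \<rho>) \<le> \<Delta> t" and "t0 \<le> t"
  shows "\<Delta> t \<le> \<Delta> t0 / (1 + \<rho>) ^ (t - t0)"
  using \<open>t0 \<le> t\<close>
proof (induction t rule: dec_induct)
  case (step t)
  have "\<Delta> (Suc t) \<le> \<Delta> t / (1 + \<rho>)"
    using assms(1) assms(2)[OF step.hyps(1)] by (simp add: field_simps)
  also have "\<dots> \<le> (\<Delta> t0 / (1 + \<rho>) ^ (t - t0)) / (1 + \<rho>)"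
    using step.IH assms(1) by (intro divide_right_mono) auto
  also have "\<dots> = \<Delta> t0 / (1 + \<rho>) ^ (Suc t - t0)"
    using step.hyps by (simp add: Suc_diff_le mult.commute)
  finally show ?case .
qed simp

text \<open>A nonnegative sequence cannot lose \<epsilon> at every step; \<open>t0\<close> is the
  first index at which the threshold is met.\<close>

lemma finitely_many_decrements:
  fixes \<Delta> :: "nat \<Rightarrow> real"
  assumes "0 < \<epsilon>" "\<And>t. 0 \<le> \<Delta> t" and "\<And>t. C < \<Delta> t \<Longrightarrow> \<Delta> (Suc t) - \<Delta> t \<le> - \<epsilon>"
  shows "\<exists>t0. (\<forall>t<t0. C < \<Delta> t \<and> \<Delta> (Suc t) - \<Delta> t \<le> - \<epsilon>) \<and> \<Delta> t0 \<le> C"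
proof -
  have "\<exists>t. \<Delta> t \<le> C"
  proof (rule ccontr)
    assume "\<nexists>t. \<Delta> t \<le> C"
    then have step: "\<Delta> (Suc t) - \<Delta> t \<le> - \<epsilon>" for t
      by (intro assms(3)) (simp add: not_le)
    have bound: "\<Delta> t \<le> \<Delta> 0 - real t * \<epsilon>" for t
    proof (induction t)
      case (Suc t)
      then show ?case using step[of t] by (simp add: algebra_simps)
    qed simp
    obtain N :: nat where "\<Delta> 0 < real N * \<epsilon>"
      using reals_Archimedean3[OF \<open>0 < \<epsilon>\<close>] by blast
    then show False
      using bound[of N] assms(2)[of N] by simp
  qed
  then have "\<Delta> (LEAST t. \<Delta> t \<le> C) \<le> C" "\<And>t. t < (LEAST t. \<Delta> t \<le> C) \<Longrightarrow> C < \<Delta> t"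
    by (auto intro: LeastI_ex dest: not_less_Least)
  then show ?thesis
    using assms(3) by blast
qed

text \<open>Even if the dual gap drops below \<open>C\<close> within the step, the decrease is large: either \<open>\<Delta>\<close> loses
  \<open>C / 2\<close>, or one of the two gaps is still at least \<open>C / 4\<close>.\<close>

lemma decrease_above_threshold:
  fixes p q \<Delta> C \<kappa> lam r \<alpha> :: real
  assumes "0 \<le> p" "0 \<le> q" "0 < C" "0 < lam" "0 < r" "r < 1" "0 \<le> \<kappa>"
    and step: "p + q + r / 2 * p + lam * r / 4 * (\<kappa> * min (q / C) 1) \<le> \<Delta>"
    and "C < \<Delta>" "\<alpha>\<^sup>2 \<le> \<kappa> / 2" "lam * \<alpha>\<^sup>2 \<le> C"
  shows "(p + q) - \<Delta> \<le> - (lam * \<alpha>\<^sup>2 * r / 8)"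
proof -
  have small: "lam * \<alpha>\<^sup>2 * r \<le> C * r"
    using assms by (intro mult_right_mono) auto
  have dual: "lam * \<alpha>\<^sup>2 * r / 8 \<le> lam * r / 4 * (\<kappa> * s)" if "1 / 4 \<le> s" for s
  proof -
    have "\<alpha>\<^sup>2 \<le> 2 * (\<kappa> * s)"
      using mult_left_mono[OF that \<open>0 \<le> \<kappa>\<close>] \<open>\<alpha>\<^sup>2 \<le> \<kappa> / 2\<close> by simp
    then have "lam * r / 8 * \<alpha>\<^sup>2 \<le> lam * r / 8 * (2 * (\<kappa> * s))"
      using assms by (intro mult_left_mono) auto
    then show ?thesis by (simp add: algebra_simps)
  qed
  have p: "0 \<le> r / 2 * p" and q: "0 \<le> lam * r / 4 * (\<kappa> * min (q / C) 1)"
    using assms by auto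
  consider "p + q < C / 2" | "C / 4 \<le> q" | "C / 4 \<le> p"
    by linarith
  then show ?thesis
  proof cases
    case 1
    have "C * r \<le> C"
      using assms by (simp add: mult_left_le)
    then show ?thesis
      using 1 \<open>C < \<Delta>\<close> small \<open>0 < C\<close> by linarith
  next
    case 2
    then have "1 / 4 \<le> min (q / C) 1"
      using \<open>0 < C\<close> by (simp add: field_simps)
    then show ?thesis
      using dual[of "min (q / C) 1"] step p by linarith
  next
    case 3
    then have "r / 2 * (C / 4) \<le> r / 2 * p"
      using assms by (intro mult_left_mono) auto
    then show ?thesis
      using step q small by (simp add: algebra_simps)
  qed
qed

text \<open>With \<open>q \<le> C\<close> the minimum is \<open>q / C\<close>, so the decrease is
  linear in both gaps, and the rate is at most the coefficient of either.\<close>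

lemma decrease_below_threshold:
  fixes p q \<Delta> C \<kappa> lam r \<alpha> :: real
  assumes "0 \<le> p" "0 \<le> q" "0 < C" "0 < lam" "0 < r"
    and step: "p + q + r / 2 * p + lam * r / 4 * (\<kappa> * min (q / C) 1) \<le> \<Delta>"
    and "q \<le> C" "\<alpha>\<^sup>2 \<le> \<kappa> / 2"
  shows "(p + q) * (1 + min (r / 2) (r * lam * \<alpha>\<^sup>2 / (8 * C))) \<le> \<Delta>"
proof -
  define \<rho> where "\<rho> = min (r / 2) (r * lam * \<alpha>\<^sup>2 / (8 * C))"
  have "\<rho> * p \<le> r / 2 * p"
    using assms by (intro mult_right_mono) (auto simp: \<rho>_def)
  moreover have "\<rho> * q \<le> lam * r / 4 * (\<kappa> * min (q / C) 1)"
  proof -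
    have "\<rho> * q \<le> r * lam * \<alpha>\<^sup>2 / (8 * C) * q"
      using assms by (intro mult_right_mono) (auto simp: \<rho>_def)
    also have "\<dots> = (r * lam / 8 * (q / C)) * \<alpha>\<^sup>2"
      using \<open>0 < C\<close> by (simp add: field_simps)
    also have "\<dots> \<le> (r * lam / 8 * (q / C)) * (2 * \<kappa>)"
    proof (rule mult_left_mono)
      have "0 \<le> \<kappa>"
        using \<open>\<alpha>\<^sup>2 \<le> \<kappa> / 2\<close> zero_le_power2[of \<alpha>] by linarith
      then show "\<alpha>\<^sup>2 \<le> 2 * \<kappa>"
        using \<open>\<alpha>\<^sup>2 \<le> \<kappa> / 2\<close> by linarith
    qed (use assms in auto)
    also have "\<dots> = lam * r / 4 * (\<kappa> * min (q / C) 1)"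
      using assms by (simp add: field_simps min_def)
    finally show ?thesis .
  qed
  ultimately show ?thesis
    using step unfolding \<rho>_def[symmetric] by (simp add: algebra_simps)
qed

text \<open>The hypotheses combine concavity of the dual function (\<open>\<delta> \<le> N r\<close>, with \<open>N\<close> the norm of a
  supergradient) with the error bound.\<close>

lemma supergradient_norm_lower_bound:
  fixes a \<delta> C r N :: real
  assumes "0 < a" "a \<le> 1" "0 < C" "0 \<le> \<delta>" "0 \<le> r" "0 \<le> N" "\<delta> \<le> N * r"
    and bound: "a\<^sup>2 / 2 * min (r\<^sup>2 / C) r \<le> \<delta>"
  shows "a ^ 4 / 4 * min (\<delta> / C) 1 \<le> N\<^sup>2"
proof (cases "\<delta> = 0")
  case False
  then have "0 < \<delta>" "0 < r"
    using assms by (auto simp: order_less_le)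
  have "a ^ 4 \<le> a\<^sup>2" "0 \<le> a ^ 4"
    using assms power_decreasing[of 2 4 a] by auto
  show ?thesis
  proof (cases "r\<^sup>2 / C \<le> r")
    case True
    have sq: "\<delta>\<^sup>2 \<le> N\<^sup>2 * r\<^sup>2"
      using power_mono[OF \<open>\<delta> \<le> N * r\<close> \<open>0 \<le> \<delta>\<close>, of 2] by (simp add: power_mult_distrib)
    have "a\<^sup>2 * r\<^sup>2 \<le> 2 * C * \<delta>"
      using bound True \<open>0 < C\<close> by (simp add: min_def field_simps)
    \<comment> \<open>Multiplying by \<delta> lets \<open>\<delta> \<le> N * r\<close> enter
      squared, after which \<open>r\<^sup>2\<close> cancels.\<close>
    then have "(a\<^sup>2 * r\<^sup>2) * \<delta> \<le> (2 * C * \<delta>) * \<delta>"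
      using \<open>0 \<le> \<delta>\<close> by (rule mult_right_mono)
    also have "\<dots> = 2 * C * \<delta>\<^sup>2"
      by (simp add: power2_eq_square)
    also have "\<dots> \<le> 2 * C * (N\<^sup>2 * r\<^sup>2)"
      using sq \<open>0 < C\<close> by (intro mult_left_mono) auto
    finally have "r\<^sup>2 * (a\<^sup>2 * \<delta>) \<le> r\<^sup>2 * (2 * C * N\<^sup>2)"
      by (simp add: algebra_simps)
    then have "a\<^sup>2 * \<delta> \<le> 2 * C * N\<^sup>2"
      using \<open>0 < r\<close> by simp
    then have "a\<^sup>2 / 2 * (\<delta> / C) \<le> N\<^sup>2"
      using \<open>0 < C\<close> by (simp add: field_simps)
    moreover have "a ^ 4 / 4 * min (\<delta> / C) 1 \<le> a\<^sup>2 / 2 * (\<delta> / C)"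
    proof (rule mult_mono)
      show "a ^ 4 / 4 \<le> a\<^sup>2 / 2"
        using \<open>a ^ 4 \<le> a\<^sup>2\<close> zero_le_power2[of a] by linarith
    qed (use assms in auto)
    ultimately show ?thesis by linarith
  next
    case False
    \<comment> \<open>In the linear regime of the error bound the distance cancels and leaves a
      constant lower bound for \<open>N\<close>; squaring it produces the factor
      \<open>a ^ 4 / 4\<close>.\<close>
    then have "a\<^sup>2 / 2 * r \<le> N * r"
      using bound \<open>\<delta> \<le> N * r\<close> by (simp add: min_def)
    then have "a\<^sup>2 / 2 \<le> N"
      using \<open>0 < r\<close> by simp
    then have "(a\<^sup>2 / 2)\<^sup>2 \<le> N\<^sup>2"
      by (rule power_mono) simp
    moreover have "(a\<^sup>2 / 2)\<^sup>2 = a ^ 4 / 4"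
      by (simp add: power_divide)
    moreover have "a ^ 4 / 4 * min (\<delta> / C) 1 \<le> a ^ 4 / 4 * 1"
      using \<open>0 \<le> a ^ 4\<close> by (intro mult_left_mono) auto
    ultimately show ?thesis by linarith
  qed
qed simp

section \<open>Supergradients of the dual function and degenerate constraints\<close>

context augmented_problem
begin

text \<open>The Lagrangian is affine in the multiplier, so \<open>M *v xh\<close> is a supergradient
  of \<open>d\<close> at \<open>y\<close>; Cauchy-Schwarz is used against every dual solution before
  taking the infimum.\<close>

lemma dual_gap_le_norm_infdist:
  assumes "xh \<in> X" "\<L> xh y = d y"
  shows "dual_opt f M lam X - d y \<le> norm (M *v xh) * infdist y (dual_argmax f M lam X)"
proof -
  let ?Y = "dual_argmax f M lam X"
  have le: "dual_opt f M lam X - d y \<le> norm (M *v xh) * dist y ys" if "ys \<in> ?Y" for ys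
  proof -
    have "dual_opt f M lam X \<le> \<L> xh ys"
      using that dual_fun_le[OF assms(1), of ys] by (simp add: dual_opt_facts(2))
    then have "dual_opt f M lam X - d y \<le> (ys - y) \<bullet> (M *v xh)"
      using aug_diff[of xh ys y] assms(2) by simp
    also have "\<dots> \<le> norm (ys - y) * norm (M *v xh)"
      by (rule norm_cauchy_schwarz)
    finally show ?thesis
      by (simp add: dist_norm norm_minus_commute mult.commute)
  qed
  show ?thesis
  proof (cases "norm (M *v xh) = 0")
    case True
    obtain ys where "ys \<in> ?Y"
      using dual_opt_facts(3) by blast
    then show ?thesis
      using le True by force
  next
    case False
    then have pos: "0 < norm (M *v xh)" by simp
    have "(dual_opt f M lam X - d y) / norm (M *v xh) \<le> infdist y ?Y"
      unfolding infdist_notempty[OF dual_opt_facts(3)]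
    proof (rule cINF_greatest[OF dual_opt_facts(3)])
      fix ys assume "ys \<in> ?Y"
      then show "(dual_opt f M lam X - d y) / norm (M *v xh) \<le> dist y ys"
        using le[of ys] pos by (simp add: pos_divide_le_eq mult.commute)
    qed
    then show ?thesis
      using pos by (simp add: pos_divide_le_eq mult.commute)
  qed
qed

text \<open>Either \<open>X\<close> is a single point, which is then the feasible one, or
  \<open>transpose M ** M\<close> vanishes, and the square of \<open>norm (M *v x)\<close> is its
  quadratic form.\<close>

lemma degenerate_constraint:
  assumes "onorm ((*v) (transpose M ** M)) * (diameter X)\<^sup>2 = 0" and "x \<in> X"
  shows "M *v x = 0"
proof (cases "diameter X = 0")
  case True
  obtain x0 where x0: "x0 \<in> X" "M *v x0 = 0"
    using feasible by blast
  have "dist x x0 \<le> 0"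
    using diameter_bounded_bound[OF X_facts(3) \<open>x \<in> X\<close> x0(1)] True by simp
  then show ?thesis
    using x0 by simp
next
  case False
  then have "onorm ((*v) (transpose M ** M)) = 0"
    using assms(1) by simp
  then have "(transpose M ** M) *v x = 0"
    using onorm_eq_0[OF matrix_vector_mul_bounded_linear] by auto
  then have "(transpose M *v (M *v x)) \<bullet> x = 0"
    by (simp add: matrix_vector_mul_assoc del: transpose_matrix_vector)
  then show ?thesis
    by (simp add: dot_lmul_matrix)
qed

end

section \<open>One iteration of the method and the two phases of convergence\<close>

locale fw_al_run = augmented_problem f M lam X
  for f :: "real^'m::finite \<Rightarrow> real" and M :: "real^'m^'n::finite" and lam X +
  fixes \<rho>\<^sub>A :: real and x :: "nat \<Rightarrow> real^'m" and w :: "nat \<Rightarrow> real^'m \<Rightarrow> real"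
    and y :: "nat \<Rightarrow> real^'n"
  assumes decrease: "geometric_decrease f M lam X \<rho>\<^sub>A"
    and run: "FW_AL f M lam X (\<lambda>_. lam * \<rho>\<^sub>A / 4) x w y"
begin

abbreviation "\<Delta>p \<equiv> primal_gap f M lam X x y"
abbreviation "\<Delta>d \<equiv> dual_gap f M lam X y"
abbreviation "\<Delta> \<equiv> total_gap f M lam X x y"

lemma rho_A: "0 < \<rho>\<^sub>A" "\<rho>\<^sub>A < 1"
  using decrease by (auto simp: geometric_decrease_def)

lemma run_step:
  "afw_loop X (\<lambda>z. \<L> z (y t)) (x t, w t) (x (Suc t), w (Suc t))"
  "y (Suc t) = y t + (lam * \<rho>\<^sub>A / 4) *\<^sub>R (M *v x (Suc t))"
  using run by (auto simp: FW_AL_def)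

lemma run_valid: "valid_state X (x t, w t)"
proof (induction t)
  case 0
  then show ?case
    using run valid_state_vertex by (auto simp: FW_AL_def)
next
  case (Suc t)
  then show ?case
    using afw_loop_valid run_step(1) by blast
qed

lemma run_mem: "x t \<in> X"
  by (rule valid_state_mem[OF X_facts(1) run_valid])

lemma gaps_nonneg: "0 \<le> \<Delta>p t" "0 \<le> \<Delta>d t" "0 \<le> \<Delta> t"
  using dual_fun_le[OF run_mem, of "y t" "Suc t"] dual_opt_facts(1)[of "y t"]
  by (auto simp: primal_gap_def dual_gap_def total_gap_def)

text \<open>The bound for the last step of the inner loop does not depend on its starting point, so
  it holds at every \<open>t\<close>, including the first.\<close>

lemma primal_gap_le:
  assumes "L_smooth L f"
  shows "\<Delta>p t \<le> smooth_diam L"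
proof -
  obtain xh where xh: "xh \<in> X" "\<L> xh (y t) = d (y t)"
    using dual_fun_attained by blast
  have "\<L> (fst (x (Suc t), w (Suc t))) (y t) - \<L> xh (y t) \<le> smooth_const L lam M * (diameter X)\<^sup>2"
    using L_smooth_aug_lagrangian[OF assms, of lam M "y t"] lam_pos
    by (intro afw_loop_gap[OF run_step(1) run_valid X_facts(1,3) _ aug_tangent xh(1)]) auto
  then show ?thesis
    by (simp add: primal_gap_def smooth_diam_def xh(2))
qed

lemma one_step:
  assumes xh: "xh \<in> X" "\<L> xh (y (Suc t)) = d (y (Suc t))"
  shows "\<Delta> (Suc t) + \<rho>\<^sub>A / 2 * \<Delta>p (Suc t) + lam * \<rho>\<^sub>A / 4 * (norm (M *v xh))\<^sup>2 \<le> \<Delta> t"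
    and "lam * \<rho>\<^sub>A / 8 * (norm (M *v x (Suc t)))\<^sup>2 \<le> \<Delta> t"
proof -
  define \<eta> where "\<eta> = lam * \<rho>\<^sub>A / 4"
  have "0 < \<eta>"
    using lam_pos rho_A by (simp add: \<eta>_def)
  define G where "G = \<L> (x (Suc t)) (y (Suc t)) - d (y (Suc t))"
  define a where "a = M *v x (Suc t)"
  define b where "b = M *v xh"
  have y: "y (Suc t) - y t = \<eta> *\<^sub>R a"
    by (simp add: run_step(2) \<eta>_def a_def)
  have "\<L> (x (Suc (Suc t))) (y (Suc t)) - \<L> (x (Suc t)) (y (Suc t)) \<le> - \<rho>\<^sub>A * G"
    using decrease run_mem run_valid run_step(1)[of "Suc t"]
    by (fastforce simp: geometric_decrease_def G_def algebra_simps)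
  then have \<Delta>p: "\<Delta>p (Suc t) \<le> G - \<rho>\<^sub>A * G"
    by (simp add: primal_gap_def G_def)
  have "d (y t) \<le> \<L> xh (y t)"
    by (rule dual_fun_le[OF xh(1)])
  then have dual: "d (y t) - d (y (Suc t)) \<le> - (\<eta> * (a \<bullet> b))"
    using aug_diff[of xh "y (Suc t)" "y t"] xh(2) by (simp add: y b_def)
  have "\<L> (x (Suc t)) (y (Suc t)) - \<L> (x (Suc t)) (y t) = \<eta> * (norm a)\<^sup>2"
    using aug_diff[of "x (Suc t)" "y (Suc t)" "y t"]
    by (simp add: y a_def[symmetric] power2_norm_eq_inner)
  \<comment> \<open>The dual value enters both gaps, whence the factor 2; the cross term then
    completes a square.\<close>
  then have "\<Delta> (Suc t) - \<Delta> t \<le> \<eta> * (norm a)\<^sup>2 - 2 * (\<eta> * (a \<bullet> b)) - \<rho>\<^sub>A * G"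
    using \<Delta>p dual by (simp add: total_gap_def dual_gap_def primal_gap_def G_def)
  also have "\<dots> = \<eta> * (norm (a - b))\<^sup>2 - \<eta> * (norm b)\<^sup>2 - \<rho>\<^sub>A * G"
    by (simp add: power2_norm_eq_inner inner_diff_left inner_diff_right inner_commute algebra_simps)
  finally have main: "\<Delta> (Suc t) - \<Delta> t \<le> \<eta> * (norm (a - b))\<^sup>2 - \<eta> * (norm b)\<^sup>2 - \<rho>\<^sub>A * G" .
  have "lam / 2 * (norm (a - b))\<^sup>2 \<le> G"
    using dual_fun_gap_quadratic[OF xh run_mem] by (simp add: a_def b_def G_def)
  then have "\<rho>\<^sub>A * (lam / 2 * (norm (a - b))\<^sup>2) \<le> \<rho>\<^sub>A * G"
    using rho_A by (intro mult_left_mono) auto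
  \<comment> \<open>The step size makes \<open>2 * \<eta>\<close> equal to
    \<open>\<rho>\<^sub>A * lam / 2\<close>, so half of the inner decrease pays for the square and
    the other half remains for the primal gap.\<close>
  then have quad: "2 * (\<eta> * (norm (a - b))\<^sup>2) \<le> \<rho>\<^sub>A * G"
    by (simp add: \<eta>_def algebra_simps)
  have "0 \<le> G"
    using dual_fun_le[OF run_mem] by (simp add: G_def)
  then have "0 \<le> \<rho>\<^sub>A * G"
    using rho_A(1) by simp
  then have "\<Delta>p (Suc t) \<le> G"
    using \<Delta>p by simp
  then have "\<rho>\<^sub>A * \<Delta>p (Suc t) \<le> \<rho>\<^sub>A * G"
    using rho_A(1) by simp
  then show "\<Delta> (Suc t) + \<rho>\<^sub>A / 2 * \<Delta>p (Suc t) + lam * \<rho>\<^sub>A / 4 * (norm (M *v xh))\<^sup>2 \<le> \<Delta> t"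
    using main quad by (simp add: \<eta>_def[symmetric] b_def[symmetric])
  \<comment> \<open>Splitting \<open>a\<close> as \<open>(a - b) + b\<close> bounds the residual by
    two squares, whose multiples by \<eta> are together at most the decrease of the total
    gap.\<close>
  have "norm a \<le> norm (a - b) + norm b"
    using norm_triangle_sub[of a b] by simp
  then have "(norm a)\<^sup>2 \<le> (norm (a - b) + norm b)\<^sup>2"
    by (rule power_mono) simp
  also have "\<dots> \<le> 2 * ((norm (a - b))\<^sup>2 + (norm b)\<^sup>2)"
    using sum_squares_bound[of "norm (a - b)" "norm b"] by (simp add: power2_sum)
  finally have "\<eta> / 2 * (norm a)\<^sup>2 \<le> \<eta> / 2 * (2 * ((norm (a - b))\<^sup>2 + (norm b)\<^sup>2))"
    using \<open>0 < \<eta>\<close> by (intro mult_left_mono) auto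
  also have "\<dots> = \<eta> * (norm (a - b))\<^sup>2 + \<eta> * (norm b)\<^sup>2"
    by (simp add: algebra_simps)
  also have "\<dots> \<le> \<Delta> t"
    using main quad gaps_nonneg(3)[of "Suc t"] by simp
  finally show "lam * \<rho>\<^sub>A / 8 * (norm (M *v x (Suc t)))\<^sup>2 \<le> \<Delta> t"
    by (simp add: \<eta>_def a_def)
qed

lemma feasibility_rate:
  assumes "\<Delta> t \<le> B"
  shows "(norm (M *v x (Suc t)))\<^sup>2 \<le> 16 / (lam * \<rho>\<^sub>A) * B"
proof -
  obtain xh where "xh \<in> X" "\<L> xh (y (Suc t)) = d (y (Suc t))"
    using dual_fun_attained by blast
  then have "lam * \<rho>\<^sub>A / 8 * (norm (M *v x (Suc t)))\<^sup>2 \<le> B"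
    using one_step(2)[of xh t] assms by simp
  moreover have "0 \<le> B"
    using gaps_nonneg(3)[of t] assms by simp
  ultimately show ?thesis
    using lam_pos rho_A by (simp add: field_simps)
qed

text \<open>Since the primal gap never exceeds \<open>C\<close>, there is no first phase when \<open>M\<close> vanishes on \<open>X\<close>;
  this includes the case \<open>C = 0\<close>, where the quotients by \<open>C\<close> are junk.\<close>

lemma two_phase_rate_degenerate:
  assumes smooth: "L_smooth L f" and degen: "\<And>x. x \<in> X \<Longrightarrow> M *v x = 0" and "0 \<le> \<rho>" "\<rho> \<le> \<rho>\<^sub>A / 2"
  shows "\<Delta> 0 \<le> smooth_diam L" and "\<Delta> t \<le> \<Delta> 0 / (1 + \<rho>) ^ (t - 0)"
proof -
  have "\<L> x y = f x" if "x \<in> X" for x y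
    using degen[OF that] by (simp add: aug_lagrangian_def)
  then have "\<Delta>d t = 0" for t
    using dual_fun_attained[of "y t"] dual_opt_facts(1)[of "y t"] dual_opt_facts(4) degen
    by (fastforce simp: dual_gap_def)
  then have \<Delta>: "\<Delta> t = \<Delta>p t" for t
    by (simp add: total_gap_def)
  then show "\<Delta> 0 \<le> smooth_diam L"
    using primal_gap_le[OF smooth] by simp
  show "\<Delta> t \<le> \<Delta> 0 / (1 + \<rho>) ^ (t - 0)"
  proof (rule geometric_rate[OF \<open>0 \<le> \<rho>\<close>])
    fix t
    obtain xh where xh: "xh \<in> X" "\<L> xh (y (Suc t)) = d (y (Suc t))"
      using dual_fun_attained by blast
    have "\<rho> * \<Delta> (Suc t) \<le> \<rho>\<^sub>A / 2 * \<Delta> (Suc t)"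
      using assms(4) gaps_nonneg(3) by (rule mult_right_mono)
    then show "\<Delta> (Suc t) * (1 + \<rho>) \<le> \<Delta> t"
      using one_step(1)[OF xh] degen[OF xh(1)] by (simp add: \<Delta> algebra_simps)
  qed simp
qed

text \<open>The bound \<open>a ^ 4 / 8\<close> is half of the constant in the supergradient
  estimate; \<open>lam * \<alpha>\<^sup>2 \<le> C\<close> lets a loss of order \<open>C\<close> pay
  for the fixed decrement of the first phase.\<close>

lemma two_phase_rate:
  assumes smooth: "L_smooth L f" and C: "C = smooth_diam L" "0 < C"
    and a: "0 < a" "a \<le> 1"
    and error: "\<And>y. a\<^sup>2 / 2 * min ((infdist y (dual_argmax f M lam X))\<^sup>2 / C)
                   (infdist y (dual_argmax f M lam X)) \<le> dual_opt f M lam X - d y"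
    and \<alpha>: "0 < \<alpha>" "\<alpha>\<^sup>2 \<le> a ^ 4 / 8" "lam * \<alpha>\<^sup>2 \<le> C"
  shows "\<exists>t0. (\<forall>t<t0. C < \<Delta> t \<and> \<Delta> (Suc t) - \<Delta> t \<le> - (lam * \<alpha>\<^sup>2 * \<rho>\<^sub>A / 8))
    \<and> \<Delta> t0 \<le> C
    \<and> (\<forall>t\<ge>t0. \<Delta> t
          \<le> \<Delta> t0 / (1 + min (\<rho>\<^sub>A / 2) (\<rho>\<^sub>A * lam * \<alpha>\<^sup>2 / (8 * C))) ^ (t - t0))"
proof -
  define \<kappa> where "\<kappa> = a ^ 4 / 4"
  have \<kappa>: "0 \<le> \<kappa>" "\<alpha>\<^sup>2 \<le> \<kappa> / 2"
    using a \<alpha>(2) by (auto simp: \<kappa>_def)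
  have split: "\<Delta> t = \<Delta>p t + \<Delta>d t" for t
    by (simp add: total_gap_def)
  have step: "\<Delta>p (Suc t) + \<Delta>d (Suc t) + \<rho>\<^sub>A / 2 * \<Delta>p (Suc t)
      + lam * \<rho>\<^sub>A / 4 * (\<kappa> * min (\<Delta>d (Suc t) / C) 1) \<le> \<Delta> t" for t
  proof -
    obtain xh where xh: "xh \<in> X" "\<L> xh (y (Suc t)) = d (y (Suc t))"
      using dual_fun_attained by blast
    have "\<kappa> * min (\<Delta>d (Suc t) / C) 1 \<le> (norm (M *v xh))\<^sup>2"
      unfolding \<kappa>_def
    proof (rule supergradient_norm_lower_bound[OF a \<open>0 < C\<close> gaps_nonneg(2) infdist_nonneg norm_ge_zero])
      show "\<Delta>d (Suc t) \<le> norm (M *v xh) * infdist (y (Suc t)) (dual_argmax f M lam X)"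
        using dual_gap_le_norm_infdist[OF xh] by (simp add: dual_gap_def)
    qed (use error[of "y (Suc t)"] in \<open>simp add: dual_gap_def\<close>)
    then have "lam * \<rho>\<^sub>A / 4 * (\<kappa> * min (\<Delta>d (Suc t) / C) 1) \<le> lam * \<rho>\<^sub>A / 4 * (norm (M *v xh))\<^sup>2"
      using lam_pos rho_A by (intro mult_left_mono) auto
    then show ?thesis
      using one_step(1)[OF xh] split[of "Suc t"] by simp
  qed
  have pos: "0 < lam * \<alpha>\<^sup>2 * \<rho>\<^sub>A / 8"
    using lam_pos rho_A \<alpha>(1) by simp
  have dec: "\<Delta> (Suc t) - \<Delta> t \<le> - (lam * \<alpha>\<^sup>2 * \<rho>\<^sub>A / 8)" if "C < \<Delta> t" for t
    unfolding split[of "Suc t"]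
    by (rule decrease_above_threshold[OF gaps_nonneg(1,2) \<open>0 < C\<close> lam_pos rho_A \<kappa>(1) step that \<kappa>(2) \<alpha>(3)])
  obtain t0 where t0: "\<forall>t<t0. C < \<Delta> t \<and> \<Delta> (Suc t) - \<Delta> t \<le> - (lam * \<alpha>\<^sup>2 * \<rho>\<^sub>A / 8)"
    "\<Delta> t0 \<le> C"
    using finitely_many_decrements[where \<Delta> = \<Delta>, OF pos gaps_nonneg(3) dec] by blast
  define \<rho> where "\<rho> = min (\<rho>\<^sub>A / 2) (\<rho>\<^sub>A * lam * \<alpha>\<^sup>2 / (8 * C))"
  have "0 \<le> \<rho>"
    using lam_pos rho_A \<open>0 < C\<close> by (simp add: \<rho>_def)
  \<comment> \<open>Monotonicity keeps the dual gap below \<open>C\<close> after \<open>t0\<close>,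
    as the linear regime requires.\<close>
  have mono: "\<Delta> (Suc t) \<le> \<Delta> t" for t
  proof -
    obtain xh where xh: "xh \<in> X" "\<L> xh (y (Suc t)) = d (y (Suc t))"
      using dual_fun_attained by blast
    have "0 \<le> \<rho>\<^sub>A / 2 * \<Delta>p (Suc t)" "0 \<le> lam * \<rho>\<^sub>A / 4 * (norm (M *v xh))\<^sup>2"
      using lam_pos rho_A gaps_nonneg(1)[of "Suc t"] by auto
    then show ?thesis
      using one_step(1)[OF xh] by linarith
  qed
  have "\<Delta> (Suc t) * (1 + \<rho>) \<le> \<Delta> t" if "t0 \<le> t" for t
  proof -
    have "\<Delta> (Suc t) \<le> \<Delta> t0"
      using lift_Suc_antimono_le[of \<Delta> t0 "Suc t"] mono that by simp
    then have "\<Delta>d (Suc t) \<le> C"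
      using t0(2) split[of "Suc t"] gaps_nonneg(1)[of "Suc t"] by linarith
    then show ?thesis
      unfolding split[of "Suc t"] \<rho>_def
      by (intro decrease_below_threshold[OF gaps_nonneg(1,2) \<open>0 < C\<close> lam_pos rho_A(1) step _ \<kappa>(2)])
  qed
  then have "\<Delta> t \<le> \<Delta> t0 / (1 + \<rho>) ^ (t - t0)" if "t0 \<le> t" for t
    using geometric_rate[OF \<open>0 \<le> \<rho>\<close>, of t0 \<Delta> t] that by blast
  then show ?thesis
    using t0 unfolding \<rho>_def by blast
qed

end

section \<open>Choice of the constant and assembly\<close>

context augmented_problem
begin

lemma linear_convergence:
  "\<exists>\<alpha>>0. \<forall>L. L_smooth L f \<longrightarrow>
    (let C = smooth_const L lam M * (diameter X)\<^sup>2;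
         Y = dual_argmax f M lam X
     in (\<forall>y. dual_opt f M lam X - dual_fun f M lam X y
               \<ge> \<alpha>\<^sup>2 / 2 * min ((infdist y Y)\<^sup>2 / C) (infdist y Y))
      \<and> (\<forall>\<rho>\<^sub>A x w y.
           geometric_decrease f M lam X \<rho>\<^sub>A \<longrightarrow>
           FW_AL f M lam X (\<lambda>_. lam * \<rho>\<^sub>A / 4) x w y \<longrightarrow>
           (let \<Delta> = total_gap f M lam X x y;
                \<rho> = min (\<rho>\<^sub>A / 2) (\<rho>\<^sub>A * lam * \<alpha>\<^sup>2 / (8 * C))
            in \<exists>t0. (\<forall>t<t0. \<Delta> t > C \<and> \<Delta> (Suc t) - \<Delta> t \<le> - (lam * \<alpha>\<^sup>2 * \<rho>\<^sub>A / 8))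
                  \<and> \<Delta> t0 \<le> C
                  \<and> (\<forall>t\<ge>t0. \<Delta> t \<le> \<Delta> t0 / (1 + \<rho>) ^ (t - t0)
                       \<and> (norm (M *v x (Suc t)))\<^sup>2
                           \<le> 16 / (lam * \<rho>\<^sub>A) * (\<Delta> t0 / (1 + \<rho>) ^ (t - t0))))))"
proof -
  obtain a where a: "0 < a" "a \<le> 1" and error: "\<And>L y. L_smooth L f \<Longrightarrow> 0 < smooth_diam L \<Longrightarrow>
       a\<^sup>2 / 2 * min ((infdist y (dual_argmax f M lam X))\<^sup>2 / smooth_diam L)
                   (infdist y (dual_argmax f M lam X))
         \<le> dual_opt f M lam X - d y"
    using dual_error_bound by blast
  define q where "q = onorm ((*v) (transpose M ** M)) * (diameter X)\<^sup>2"
  \<comment> \<open>The term \<open>a\<^sup>2 / 4\<close> serves the error bound and the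
    supergradient estimate; \<open>sqrt q\<close> yields
    \<open>lam * \<alpha>\<^sup>2 \<le> lam * q\<close>, which is at most \<open>C\<close> for every
    \<open>L\<close>. If \<open>q = 0\<close>, the constraint vanishes on \<open>X\<close> and the
    value 1 is arbitrary.\<close>
  define \<alpha> where "\<alpha> = min (a\<^sup>2 / 4) (if 0 < q then sqrt q else 1)"
  have \<alpha>: "0 < \<alpha>" "\<alpha> \<le> a\<^sup>2 / 4"
    using a by (auto simp: \<alpha>_def)
  have \<alpha>_q: "\<alpha>\<^sup>2 \<le> q" if "0 < q"
  proof -
    have "\<alpha>\<^sup>2 \<le> (sqrt q)\<^sup>2"
      using \<alpha>(1) that by (intro power_mono) (auto simp: \<alpha>_def)
    then show ?thesis
      using that by simp
  qed
  have "\<alpha>\<^sup>2 \<le> (a\<^sup>2 / 4)\<^sup>2"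
    using \<alpha> by (intro power_mono) auto
  moreover have "(a\<^sup>2 / 4)\<^sup>2 = a ^ 4 / 16"
    by (simp add: power_divide)
  ultimately have \<alpha>_a4: "\<alpha>\<^sup>2 \<le> a ^ 4 / 8"
    using zero_le_power2[of \<alpha>] by linarith
  have "a\<^sup>2 \<le> a"
    using a by (simp add: power2_eq_square mult_left_le)
  then have "\<alpha>\<^sup>2 \<le> a\<^sup>2"
    using \<alpha> a by (intro power_mono) auto
  have q: "0 \<le> q"
    unfolding q_def by (simp add: onorm_pos_le matrix_vector_mul_bounded_linear)
  show ?thesis
  proof (rule exI[of _ \<alpha>], intro conjI allI impI \<alpha>(1), unfold Let_def, intro conjI allI impI,
      goal_cases)
    case (1 L y)
    let ?r = "infdist y (dual_argmax f M lam X)"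
    show ?case
    \<comment> \<open>A zero denominator makes the quotient 0, so the claim reduces to nonnegativity
      of the dual gap.\<close>
    proof (cases "smooth_diam L = 0")
      case True
      then have "min (?r\<^sup>2 / smooth_diam L) ?r = 0"
        by (simp add: infdist_nonneg)
      then show ?thesis
        using dual_opt_facts(1)[of y] unfolding smooth_diam_def by simp
    next
      case False
      then have pos: "0 < smooth_diam L"
        using smooth_diam_nonneg[OF 1] by simp
      then have "\<alpha>\<^sup>2 / 2 * min (?r\<^sup>2 / smooth_diam L) ?r \<le> a\<^sup>2 / 2 * min (?r\<^sup>2 / smooth_diam L) ?r"
        using \<open>\<alpha>\<^sup>2 \<le> a\<^sup>2\<close> by (intro mult_right_mono) (auto simp: infdist_nonneg)
      then show ?thesis
        using error[OF 1 pos, of y] by (simp add: smooth_diam_def)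
    qed
  next
    case (2 L \<rho>\<^sub>A x w y)
    interpret fw_al_run f M lam X \<rho>\<^sub>A x w y
      using 2 by unfold_locales
    let ?\<rho> = "min (\<rho>\<^sub>A / 2) (\<rho>\<^sub>A * lam * \<alpha>\<^sup>2 / (8 * smooth_diam L))"
    have "\<exists>t0. (\<forall>t<t0. smooth_diam L < \<Delta> t \<and> \<Delta> (Suc t) - \<Delta> t \<le> - (lam * \<alpha>\<^sup>2 * \<rho>\<^sub>A / 8))
        \<and> \<Delta> t0 \<le> smooth_diam L \<and> (\<forall>t\<ge>t0. \<Delta> t \<le> \<Delta> t0 / (1 + ?\<rho>) ^ (t - t0))"
    proof (cases "q = 0")
      case True
      have degen: "M *v u = 0" if "u \<in> X" for u
        using degenerate_constraint[OF _ that] True by (simp add: q_def)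
      have "0 \<le> ?\<rho>"
        using rho_A lam_pos smooth_diam_nonneg[OF 2(1)] by simp
      then show ?thesis
        using two_phase_rate_degenerate[OF 2(1) degen, of ?\<rho>] by (intro exI[of _ 0]) auto
    next
      case False
      then have "0 < q"
        using q by simp
      have "lam * q \<le> smooth_diam L"
        using smooth_diam_ge[OF 2(1)] by (simp add: q_def)
      moreover have "0 < lam * q" "lam * \<alpha>\<^sup>2 \<le> lam * q"
        using \<open>0 < q\<close> lam_pos \<alpha>_q by auto
      ultimately have pos: "0 < smooth_diam L" and le: "lam * \<alpha>\<^sup>2 \<le> smooth_diam L"
        by linarith+
      show ?thesis
        by (rule two_phase_rate[OF 2(1) refl pos a error[OF 2(1) pos] \<alpha>(1) \<alpha>_a4 le])
    qed
    then show ?case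
      using feasibility_rate unfolding smooth_diam_def by blast
  qed
qed

end

section \<open>Reduction of the block form to a single linear constraint\<close>

theorem theorem3:
  fixes f :: "real^'m::finite \<Rightarrow> real"
    and blk :: "'m \<Rightarrow> 'k::finite"
    and Xs :: "'k \<Rightarrow> (real^'m) set" and X :: "(real^'m) set"
    and A :: "'k \<Rightarrow> real^'m^'n::finite" and M :: "real^'m^'n"
    and lam :: real
  assumes "convex_on UNIV f"
    and "generalized_strongly_convex TYPE('p::finite) f"
    and "\<exists>L. L_smooth L f"
    and "\<And>k. Xs k \<subseteq> block_space blk k"
    and "\<And>k. convex (Xs k)"
    and "\<And>k. compact (Xs k)"
    and "X = block_product blk Xs"
    and "polytope X"
    and "M = block_matrix blk A"
    and "lam > 0"
    and "\<exists>xbar. (\<forall>k. xbar k \<in> rel_interior (Xs k)) \<and> (\<Sum>k\<in>UNIV. A k *v xbar k) = 0"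
  shows "\<exists>\<alpha>>0. \<forall>L. L_smooth L f \<longrightarrow>
    (let C = smooth_const L lam M * (diameter X)\<^sup>2;
         Y = dual_argmax f M lam X
     in (\<forall>y. dual_opt f M lam X - dual_fun f M lam X y
               \<ge> \<alpha>\<^sup>2 / 2 * min ((infdist y Y)\<^sup>2 / C) (infdist y Y))
      \<and> (\<forall>\<rho>\<^sub>A x w y.
           geometric_decrease f M lam X \<rho>\<^sub>A \<longrightarrow>
           FW_AL f M lam X (\<lambda>_. lam * \<rho>\<^sub>A / 4) x w y \<longrightarrow>
           (let \<Delta> = total_gap f M lam X x y;
                \<rho> = min (\<rho>\<^sub>A / 2) (\<rho>\<^sub>A * lam * \<alpha>\<^sup>2 / (8 * C))
            in \<exists>t0. (\<forall>t<t0. \<Delta> t > C \<and> \<Delta> (Suc t) - \<Delta> t \<le> - (lam * \<alpha>\<^sup>2 * \<rho>\<^sub>A / 8))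
                  \<and> \<Delta> t0 \<le> C
                  \<and> (\<forall>t\<ge>t0. \<Delta> t \<le> \<Delta> t0 / (1 + \<rho>) ^ (t - t0)
                       \<and> (norm (M *v x (Suc t)))\<^sup>2
                           \<le> 16 / (lam * \<rho>\<^sub>A) * (\<Delta> t0 / (1 + \<rho>) ^ (t - t0))))))"
proof -
  obtain xbar where xbar: "\<And>k. xbar k \<in> rel_interior (Xs k)" "(\<Sum>k\<in>UNIV. A k *v xbar k) = 0"
    using assms(11) by blast
  have mem: "xbar k \<in> Xs k" for k
    using xbar(1) rel_interior_subset by blast
  \<comment> \<open>Coordinate \<open>j\<close> is taken from its own block; as each factor lies in
    its coordinate subspace, the blocks of \<open>x0\<close> are the given points.\<close>
  define x0 where "x0 = (\<chi> j. xbar (blk j) $ j)"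
  have block: "block blk k x0 = xbar k" for k
    using mem[of k] assms(4)[of k] by (auto simp: block_def x0_def vec_eq_iff block_space_def)
  have "x0 \<in> X" "M *v x0 = 0"
    using mem xbar(2) by (simp_all add: assms(7,9) block_product_def block block_matrix_mult)
  then interpret augmented_problem f M lam X
    using assms by unfold_locales (auto simp: L_smooth_def)
  show ?thesis
    by (rule linear_convergence)
qed

end
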